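(* Let $\Gamma\subset\mathbb{R}^n$ be the attractor of an iterated function system $\{s_1,\dots,s_M\}$ of contracting similarities satisfying the open set condition, and let $\mu,\mu'$ be invariant measures on $\Gamma$ with weights $(p_1,\dots,p_M)$ and $(p_1',\dots,p_M')$ respectively. Suppose that $\Gamma$ is disjoint, i.e. $\min_{m\ne m'}\mathrm{dist}(s_m(\Gamma),s_{m'}(\Gamma))>0$. Let $0\le t<t_*$, where $t_*$ is the unique positive solution of $\sum_{m=1}^Mp_mp_m'\rho_m^{-t_*}=1$. Let $0<h<\mathrm{diam}(\Gamma)$, and assume that $\mathrm{Hull}(\Gamma_{\boldsymbol m})\cap\mathrm{Hull}(\Gamma_{\boldsymbol m'})=\emptyset$ for all $\boldsymbol m,\boldsymbol m'\in L_h(\Gamma)$ such that $m_1\ne m_1'$. Then the quadrature rule $Q^h_{\Gamma,\Gamma,t}$ (defined in the context) for the integral $I_{\Gamma,\Gamma}[\Phi_t]=\int_\Gamma\int_\Gamma\Phi_t(x,y)\,d\mu'(y)\,d\mu(x)$ satisfies $$\big|I_{\Gamma,\Gamma}[\Phi_t]-Q^h_{\Gamma,\Gamma,t}\big|\le\frac{2n\,a_t\,h^2\mu(\Gamma)\mu'(\Gamma)}{\Big(1-\sum_{m=1}^Mp_mp_m'\rho_m^{-t}\Big)R_{\Gamma,\mathrm{Hull},h}^{t+2}},$$ where $a_0:=2$, $a_t:=t(t+2)$ for $t>0$, and $$R_{\Gamma,\mathrm{Hull},h}:=\min_{\boldsymbol m,\boldsymbol m'\in L_h(\Gamma),\,m_1\ne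 m_1'}\mathrm{dist}\big(\mathrm{Hull}(\Gamma_{\boldsymbol m}),\mathrm{Hull}(\Gamma_{\boldsymbol m'})\big)\ \ge\ R_{\Gamma,\mathrm{Hull}}:=\min_{m\ne m'}\mathrm{dist}\big(s_m(\mathrm{Hull}(\Gamma)),s_{m'}(\mathrm{Hull}(\Gamma))\big).$$
   Context: IFS: a collection $\{s_1,\dots,s_M\}$, $M\ge2$, of maps $s_m:\mathbb{R}^n\to\mathbb{R}^n$, $s_m(x)=\rho_mA_mx+\delta_m$, with $\rho_m\in(0,1)$, $A_m$ an orthogonal $n\times n$ matrix, $\delta_m\in\mathbb{R}^n$. Its attractor $\Gamma$ is the unique non-empty compact set with $\Gamma=\bigcup_{m=1}^Ms_m(\Gamma)$. Open set condition: there is a non-empty bounded open set $O\subset\mathbb{R}^n$ with $\bigcup_ms_m(O)\subset O$ and $s_m(O)\cap s_{m'}(O)=\emptyset$ for $m\ne m'$. Invariant measure with weights $(p_1,\dots,p_M)$, where $p_m\in(0,1)$ and $\sum_mp_m=1$: a non-zero finite Borel regular measure $\mu$ supported on $\Gamma$ such that $\mu(A)=\sum_{m=1}^Mp_m\mu(s_m^{-1}(A))$ for every measurable $A\subset\mathbb{R}^n$. Vector indices: $I_\ell:=\{1,\dots,M\}^\ell$ for $\ell\in\mathbb{N}=\{1,2,\ldots\}$; for $\boldsymbol m=(m_1,\dots,m_\ell)\in I_\ell$, $\Gamma_{\boldsymbol m}:=s_{m_1}\circ\dots\circ s_{m_\ell}(\Gamma)$; $\Gamma_0:=\Gamma$.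 For $0<h<\mathrm{diam}(\Gamma)$, $L_h(\Gamma)$ is the set of all $\boldsymbol m=(m_1,\dots,m_\ell)\in\bigcup_{\ell'\in\mathbb{N}}I_{\ell'}$ with $\mathrm{diam}(\Gamma_{\boldsymbol m})\le h$ and $\mathrm{diam}(\Gamma_{(m_1,\dots,m_{\ell-1})})>h$ (with $\Gamma_{(m_1,\dots,m_{\ell-1})}$ replaced by $\Gamma$ if $\ell=1$); $L_h(\Gamma):=\{0\}$ for $h\ge\mathrm{diam}(\Gamma)$. $\mathrm{Hull}$ denotes convex hull. Each $\Gamma_m$, $m\in\{1,\dots,M\}$, is the attractor of the IFS $\{s_m\circ s_j\circ s_m^{-1}\}_{j=1}^M$; with respect to this IFS, $(\Gamma_m)_{\boldsymbol n}=\Gamma_{(m,\boldsymbol n)}$, with $\Gamma_{(m,0)}:=\Gamma_m$. For $0<h<\mathrm{diam}(\Gamma_m)$, $L_h(\Gamma_m)$ is the set of all $\boldsymbol n=(n_1,\dots,n_\ell)\in\bigcup_{\ell'\in\mathbb{N}}I_{\ell'}$ with $\mathrm{diam}(\Gamma_{(m,\boldsymbol n)})\le h$ and $\mathrm{diam}(\Gamma_{(m,n_1,\dots,n_{\ell-1})})>h$ (with $\Gamma_{(m,n_1,\dots,n_{\ell-1})}$ replaced by $\Gamma_m$ if $\ell=1$); $L_h(\Gamma_m):=\{0\}$ for $h\ge\mathrm{diam}(\Gamma_m)$. The iterated barycentre rule is $$Q^h_{\Gamma_m,\Gamma_{m'}}[f]:=\sum_{\boldsymbol n\in L_h(\Gamma_m)}\sum_{\boldsymbol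 n'\in L_h(\Gamma_{m'})}\mu(\Gamma_{(m,\boldsymbol n)})\,\mu'(\Gamma_{(m',\boldsymbol n')})\,f(x_{(m,\boldsymbol n)},x'_{(m',\boldsymbol n')}),$$ where $x_{\boldsymbol k}:=\int_{\Gamma_{\boldsymbol k}}x\,d\mu(x)/\mu(\Gamma_{\boldsymbol k})$ and $x'_{\boldsymbol k}:=\int_{\Gamma_{\boldsymbol k}}x\,d\mu'(x)/\mu'(\Gamma_{\boldsymbol k})$. For $x\ne y$: $\Phi_0(x,y):=\log|x-y|$ and $\Phi_t(x,y):=|x-y|^{-t}$ for $t>0$. The quadrature rule is $$Q^h_{\Gamma,\Gamma,t}:=\begin{cases}\Big(1-\sum_{m=1}^Mp_mp_m'\Big)^{-1}\sum_{m=1}^M\Big(p_mp_m'\mu(\Gamma)\mu'(\Gamma)\log\rho_m+\sum_{m'=1,\,m'\ne m}^MQ^h_{\Gamma_m,\Gamma_{m'}}[\Phi_t]\Big),&t=0,\\\Big(1-\sum_{m=1}^Mp_mp_m'\rho_m^{-t}\Big)^{-1}\sum_{m=1}^M\sum_{m'=1,\,m'\ne m}^MQ^h_{\Gamma_m,\Gamma_{m'}}[\Phi_t],&t\in(0,t_* ).\end{cases}$$ *)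

theory Defs
  imports "HOL-Analysis.Analysis"
begin

definition similarity_ifs ::
  "nat \<Rightarrow> (nat \<Rightarrow> real) \<Rightarrow> (nat \<Rightarrow> real ^ 'n ^ 'n) \<Rightarrow> (nat \<Rightarrow> real ^ 'n) \<Rightarrow>
   (nat \<Rightarrow> real ^ 'n \<Rightarrow> real ^ 'n) \<Rightarrow> bool"
where
  "similarity_ifs M \<rho> A \<delta> s \<longleftrightarrow>
     2 \<le> M \<and>
     (\<forall>m\<in>{1..M}. 0 < \<rho> m \<and> \<rho> m < 1 \<and> orthogonal_matrix (A m) \<and>
        (\<forall>x. s m x = \<rho> m *\<^sub>R (A m *v x) + \<delta> m))"

definition is_attractor ::
  "nat \<Rightarrow> (nat \<Rightarrow> real ^ 'n \<Rightarrow> real ^ 'n) \<Rightarrow> (real ^ 'n) set \<Rightarrow> bool"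
where
  "is_attractor M s \<Gamma> \<longleftrightarrow> \<Gamma> \<noteq> {} \<and> compact \<Gamma> \<and> \<Gamma> = (\<Union>m\<in>{1..M}. s m ` \<Gamma>)"

definition open_set_condition ::
  "nat \<Rightarrow> (nat \<Rightarrow> real ^ 'n \<Rightarrow> real ^ 'n) \<Rightarrow> bool"
where
  "open_set_condition M s \<longleftrightarrow>
     (\<exists>U. U \<noteq> {} \<and> bounded U \<and> open U \<and> (\<Union>m\<in>{1..M}. s m ` U) \<subseteq> U \<and>
        (\<forall>m\<in>{1..M}. \<forall>m'\<in>{1..M}. m \<noteq> m' \<longrightarrow> s m ` U \<inter> s m' ` U = {}))"

(* A Borel regular (outer) measure is determined by its restriction to the Borel sets,
   and every measure on the Borel sets arises in this way.  Hence it is modelled here by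
   a measure whose sigma-algebra is the Borel one; regularity is then automatic. *)
definition invariant_measure ::
  "nat \<Rightarrow> (nat \<Rightarrow> real ^ 'n \<Rightarrow> real ^ 'n) \<Rightarrow> (real ^ 'n) set \<Rightarrow> (nat \<Rightarrow> real) \<Rightarrow>
   (real ^ 'n) measure \<Rightarrow> bool"
where
  "invariant_measure M s \<Gamma> p \<mu> \<longleftrightarrow>
     (\<forall>m\<in>{1..M}. 0 < p m \<and> p m < 1) \<and> (\<Sum>m=1..M. p m) = 1 \<and>
     sets \<mu> = sets borel \<and> finite_measure \<mu> \<and> measure \<mu> UNIV \<noteq> 0 \<and>
     measure \<mu> (- \<Gamma>) = 0 \<and>
     (\<forall>B\<in>sets borel. measure \<mu> B = (\<Sum>m=1..M. p m * measure \<mu> (s m -` B)))"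

definition disjoint_attractor ::
  "nat \<Rightarrow> (nat \<Rightarrow> real ^ 'n \<Rightarrow> real ^ 'n) \<Rightarrow> (real ^ 'n) set \<Rightarrow> bool"
where
  "disjoint_attractor M s \<Gamma> \<longleftrightarrow>
     Min {setdist (s m ` \<Gamma>) (s m' ` \<Gamma>) | m m'. m \<in> {1..M} \<and> m' \<in> {1..M} \<and> m \<noteq> m'} > 0"

(* Vector indices are lists [m1, ..., ml] over {1..M}.  The special index 0, with
   Gamma_0 = Gamma and Gamma_(m,0) = Gamma_m, is the empty list. *)
definition piece ::
  "(nat \<Rightarrow> real ^ 'n \<Rightarrow> real ^ 'n) \<Rightarrow> (real ^ 'n) set \<Rightarrow> nat list \<Rightarrow> (real ^ 'n) set"
where
  "piece s \<Gamma> w = foldr s w ` \<Gamma>"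

(* L_h(Gamma_w) for the subset Gamma_w with its own IFS; thus w = [] gives L_h(Gamma)
   and w = [m] gives L_h(Gamma_m).  Indices are relative to Gamma_w. *)
definition L_index ::
  "nat \<Rightarrow> (nat \<Rightarrow> real ^ 'n \<Rightarrow> real ^ 'n) \<Rightarrow> (real ^ 'n) set \<Rightarrow> real \<Rightarrow> nat list \<Rightarrow>
   nat list set"
where
  "L_index M s \<Gamma> h w =
     (if h < diameter (piece s \<Gamma> w)
      then {v. v \<noteq> [] \<and> set v \<subseteq> {1..M} \<and>
               diameter (piece s \<Gamma> (w @ v)) \<le> h \<and>
               diameter (piece s \<Gamma> (w @ butlast v)) > h}
      else {[]})"

definition barycentre :: "(real ^ 'n) measure \<Rightarrow> (real ^ 'n) set \<Rightarrow> real ^ 'n"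
where
  "barycentre \<mu> B = (LINT x:B|\<mu>. x) /\<^sub>R measure \<mu> B"

definition barycentre_rule ::
  "nat \<Rightarrow> (nat \<Rightarrow> real ^ 'n \<Rightarrow> real ^ 'n) \<Rightarrow> (real ^ 'n) set \<Rightarrow>
   (real ^ 'n) measure \<Rightarrow> (real ^ 'n) measure \<Rightarrow> real \<Rightarrow> nat \<Rightarrow> nat \<Rightarrow>
   (real ^ 'n \<Rightarrow> real ^ 'n \<Rightarrow> real) \<Rightarrow> real"
where
  "barycentre_rule M s \<Gamma> \<mu> \<mu>' h m m' f =
     (\<Sum>v\<in>L_index M s \<Gamma> h [m]. \<Sum>v'\<in>L_index M s \<Gamma> h [m'].
        measure \<mu> (piece s \<Gamma> (m # v)) * measure \<mu>' (piece s \<Gamma> (m' # v')) *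
        f (barycentre \<mu> (piece s \<Gamma> (m # v))) (barycentre \<mu>' (piece s \<Gamma> (m' # v'))))"

(* Only meaningful off the diagonal; on it, the value is 0 by the conventions
   ln 0 = 0 and 0 powr a = 0. *)
definition \<Phi> :: "real \<Rightarrow> real ^ 'n \<Rightarrow> real ^ 'n \<Rightarrow> real"
where
  "\<Phi> t x y = (if t = 0 then ln (norm (x - y)) else norm (x - y) powr (- t))"

definition energy_integral ::
  "(real ^ 'n) set \<Rightarrow> (real ^ 'n) measure \<Rightarrow> (real ^ 'n) measure \<Rightarrow>
   (real ^ 'n \<Rightarrow> real ^ 'n \<Rightarrow> real) \<Rightarrow> real"
where
  "energy_integral \<Gamma> \<mu> \<mu>' f = (LINT x:\<Gamma>|\<mu>. (LINT y:\<Gamma>|\<mu>'. f x y))"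

definition t_star ::
  "nat \<Rightarrow> (nat \<Rightarrow> real) \<Rightarrow> (nat \<Rightarrow> real) \<Rightarrow> (nat \<Rightarrow> real) \<Rightarrow> real"
where
  "t_star M \<rho> p p' = (THE t. 0 < t \<and> (\<Sum>m=1..M. p m * p' m * \<rho> m powr (- t)) = 1)"

definition energy_rule ::
  "nat \<Rightarrow> (nat \<Rightarrow> real) \<Rightarrow> (nat \<Rightarrow> real ^ 'n \<Rightarrow> real ^ 'n) \<Rightarrow> (real ^ 'n) set \<Rightarrow>
   (nat \<Rightarrow> real) \<Rightarrow> (nat \<Rightarrow> real) \<Rightarrow> (real ^ 'n) measure \<Rightarrow> (real ^ 'n) measure \<Rightarrow>
   real \<Rightarrow> real \<Rightarrow> real"
where
  "energy_rule M \<rho> s \<Gamma> p p' \<mu> \<mu>' h t =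
     (if t = 0
      then inverse (1 - (\<Sum>m=1..M. p m * p' m)) *
             (\<Sum>m=1..M. p m * p' m * measure \<mu> \<Gamma> * measure \<mu>' \<Gamma> * ln (\<rho> m) +
                (\<Sum>m'\<in>{1..M} - {m}. barycentre_rule M s \<Gamma> \<mu> \<mu>' h m m' (\<Phi> t)))
      else inverse (1 - (\<Sum>m=1..M. p m * p' m * \<rho> m powr (- t))) *
             (\<Sum>m=1..M. \<Sum>m'\<in>{1..M} - {m}. barycentre_rule M s \<Gamma> \<mu> \<mu>' h m m' (\<Phi> t)))"

definition a_const :: "real \<Rightarrow> real"
where
  "a_const t = (if t = 0 then 2 else t * (t + 2))"

definition R_Hull_h ::
  "nat \<Rightarrow> (nat \<Rightarrow> real ^ 'n \<Rightarrow> real ^ 'n) \<Rightarrow> (real ^ 'n) set \<Rightarrow> real \<Rightarrow> real"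
where
  "R_Hull_h M s \<Gamma> h =
     Min {setdist (convex hull (piece s \<Gamma> w)) (convex hull (piece s \<Gamma> w')) | w w'.
            w \<in> L_index M s \<Gamma> h [] \<and> w' \<in> L_index M s \<Gamma> h [] \<and> hd w \<noteq> hd w'}"

definition R_Hull ::
  "nat \<Rightarrow> (nat \<Rightarrow> real ^ 'n \<Rightarrow> real ^ 'n) \<Rightarrow> (real ^ 'n) set \<Rightarrow> real"
where
  "R_Hull M s \<Gamma> =
     Min {setdist (s m ` (convex hull \<Gamma>)) (s m' ` (convex hull \<Gamma>)) | m m'.
            m \<in> {1..M} \<and> m' \<in> {1..M} \<and> m \<noteq> m'}"

end

theory Submission
  imports Defs "HOL-Library.Sublist"
begin

text \<open>
  Write \<open>E\<close> for the energy integral and \<open>\<Gamma>\<^sub>m\<close> for \<open>s m ` \<Gamma>\<close>.  The error estimate rests on the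
  self-similarity of \<open>E\<close>.  As the \<open>\<Gamma>\<^sub>m\<close> are disjoint, the invariance of \<open>\<mu>\<close> says that \<open>\<mu>\<close> restricted
  to \<open>\<Gamma>\<^sub>m\<close> is \<open>p m\<close> times the image of \<open>\<mu>\<close> under \<open>s m\<close>, and likewise for \<open>\<mu>'\<close>.  The kernel is
  homogeneous (for \<open>t > 0\<close>) or changes by the constant \<open>ln (\<rho> m)\<close> (for \<open>t = 0\<close>) under \<open>s m\<close>.  Hence the
  diagonal blocks \<open>\<Gamma>\<^sub>m \<times> \<Gamma>\<^sub>m\<close> of the double integral are known multiples of \<open>E\<close> plus known constants,
  and solving for \<open>E\<close> leaves the blocks \<open>\<Gamma>\<^sub>m \<times> \<Gamma>\<^sub>m'\<close> with \<open>m \<noteq> m'\<close>, where the kernel is smooth: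
  this is \<open>energy_integral_recursion\<close>.  The quadrature rule solves the same equation with these blocks
  replaced by barycentre rules, so its error is the sum of the off-diagonal errors divided by
  \<open>1 - (\<Sum>m=1..M. p m * p' m * \<rho> m powr (- t))\<close>, which is positive because \<open>t < t_star\<close>.

  Solving for \<open>E\<close> presupposes that \<open>E\<close> is finite, which is not clear for a singular kernel, as the
  equation also admits an infinite value.  Truncating \<open>\<bar>\<Phi> t\<bar>\<close> at height \<open>k\<close> turns the recursion into
  an inequality between finite numbers with a bound that is uniform in \<open>k\<close>
  (\<open>self_similar_integrable\<close>).  For \<open>t = 0\<close> the scaling law fails on the diagonal, which is null
  because points have measure zero (\<open>singleton_null\<close>).

  On one pair of small pieces \<open>B\<close>, \<open>B'\<close> the kernel is expanded to first order about the pair of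
  barycentres.  The linear terms integrate to zero.  The second derivative of \<open>\<Phi> t\<close> along a segment
  of differences of points in the two convex hulls is at most \<open>a_const t / R powr (t + 2)\<close> times the
  squared length of the segment, which is at most \<open>2 * h\<close>; this gives \<open>kernel_barycentre_error\<close>.
  Finally \<open>L_index\<close> partitions each \<open>\<Gamma>\<^sub>m\<close> into pieces of diameter at most \<open>h\<close> (\<open>UN_pieces\<close>,
  \<open>L_index_disjoint\<close>), so the local errors add up to a multiple of \<open>\<mu> \<Gamma> * \<mu>' \<Gamma>\<close>.  These
  estimates are free of the dimension; the factor \<open>CARD('n)\<close> comes from \<open>1 \<le> CARD('n)\<close>.
\<close>

section \<open>The kernel and its Taylor expansion\<close>

lemma kernel_borel: "(\<lambda>z. \<Phi> t (fst z) (snd z)) \<in> borel_measurable borel"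
proof -
  have "(\<lambda>z. \<Phi> t (fst z) (snd z :: real ^ 'n)) \<in> borel_measurable (borel \<Otimes>\<^sub>M borel)"
    unfolding \<Phi>_def by measurable
  then show ?thesis by (simp add: borel_prod)
qed

lemma kernel_continuous: "continuous_on {z. fst z \<noteq> snd z} (\<lambda>z. \<Phi> t (fst z) (snd z))"
proof (cases "t = 0")
  case True
  then show ?thesis unfolding \<Phi>_def by (auto intro!: continuous_intros)
next
  case False
  then show ?thesis unfolding \<Phi>_def by (auto intro!: continuous_intros)
qed

text \<open>
  The radial derivative of the kernel is \<open>kernel_slope t * r powr (- t - 1)\<close>, with the factor \<open>1\<close> for
  the logarithm.  Using this factor, the derivatives of both kernels have one common formula.
\<close>

definition kernel_slope :: "real \<Rightarrow> real" where
  "kernel_slope t = (if t = 0 then 1 else - t)"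

definition kernel_gradient :: "real \<Rightarrow> real ^ 'n \<Rightarrow> real ^ 'n" where
  "kernel_gradient t z = (kernel_slope t * norm z powr (- t - 2)) *\<^sub>R z"

lemma abs_kernel_slope: "0 \<le> t \<Longrightarrow> \<bar>kernel_slope t\<bar> * (t + 2) = a_const t"
  by (simp add: kernel_slope_def a_const_def)

lemma a_const_nonneg: "0 \<le> t \<Longrightarrow> 0 \<le> a_const t"
  by (simp add: a_const_def)

lemma norm_powr_eq_square_powr:
  fixes v :: "real ^ 'n"
  shows "norm v powr r = (v \<bullet> v) powr (r / 2)"
proof (cases "v = 0")
  case False
  then have "norm v > 0" by simp
  then show ?thesis
    by (simp add: dot_square_norm powr_powr flip: powr_numeral)
qed simp

text \<open>
  Along a line \<open>v u\<close> with direction \<open>d\<close>, set \<open>Q = v u \<bullet> v u\<close>, \<open>L = v u \<bullet> d\<close> and \<open>D = d \<bullet> d\<close>; then the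
  expression is the second derivative of the kernel.  By Cauchy-Schwarz the two terms in brackets
  lie in \<open>[0, (t + 2) * P]\<close> for \<open>P = D * Q powr (- t / 2 - 1)\<close>, and hence so does the modulus of their
  difference.
\<close>

lemma second_derivative_bound:
  fixes t Q L D R :: real
  assumes "0 \<le> t" "0 < R" "R\<^sup>2 \<le> Q" "0 \<le> D" "L\<^sup>2 \<le> Q * D"
  shows "\<bar>kernel_slope t * (D * Q powr (- t / 2 - 1) - (t + 2) * L\<^sup>2 * Q powr (- t / 2 - 2))\<bar>
           \<le> a_const t * D / R powr (t + 2)"
proof -
  have Q: "Q > 0" using assms by (smt (verit) zero_less_power)
  define P where "P = Q powr (- t / 2 - 1)"
  define X where "X = L\<^sup>2 * Q powr (- t / 2 - 2)"
  have P0: "P \<ge> 0" by (simp add: P_def)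
  have X0: "X \<ge> 0" by (simp add: X_def)
  have PQ: "Q * Q powr (- t / 2 - 2) = P"
  proof -
    have "Q powr 1 * Q powr (- t / 2 - 2) = Q powr (1 + (- t / 2 - 2))"
      by (rule powr_add[symmetric])
    moreover have "1 + (- t / 2 - 2) = - t / 2 - 1" by simp
    ultimately show ?thesis using Q unfolding P_def by (metis abs_of_pos powr_one')
  qed
  have "X \<le> (Q * D) * Q powr (- t / 2 - 2)"
    unfolding X_def using assms(5) by (intro mult_right_mono) auto
  also have "\<dots> = D * P" using PQ by (simp add: mult_ac)
  finally have XP: "X \<le> D * P" .
  have "(t + 2) * X \<le> (t + 2) * (D * P)" using XP assms(1) by (intro mult_left_mono) auto
  moreover have "0 \<le> (t + 2) * X" using X0 assms(1) by auto
  moreover have "0 \<le> D * P" using assms(4) P0 by auto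
  moreover have "D * P \<le> (t + 2) * (D * P)"
    using mult_right_mono[of 1 "t + 2" "D * P"] assms(1) calculation(3) by auto
  ultimately have "\<bar>D * P - (t + 2) * X\<bar> \<le> (t + 2) * (D * P)" by linarith
  then have "\<bar>kernel_slope t\<bar> * \<bar>D * P - (t + 2) * X\<bar> \<le> \<bar>kernel_slope t\<bar> * ((t + 2) * (D * P))"
    by (intro mult_left_mono) auto
  also have "\<dots> = a_const t * D * P" using abs_kernel_slope[OF assms(1)] by (simp add: mult_ac)
  also have "\<dots> \<le> a_const t * D * ((R\<^sup>2) powr (- t / 2 - 1))"
    unfolding P_def using assms a_const_nonneg[OF assms(1)]
    by (intro mult_left_mono powr_mono2') auto
  also have "(R\<^sup>2) powr (- t / 2 - 1) = R powr (- (t + 2))"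
    using assms(2) by (simp add: powr_powr algebra_simps flip: powr_numeral)
  also have "a_const t * D * R powr (- (t + 2)) = a_const t * D / R powr (t + 2)"
    unfolding powr_minus by (simp add: divide_inverse)
  finally show ?thesis by (simp add: abs_mult X_def P_def mult_ac)
qed

text \<open>
  A Taylor expansion in one variable, along the segment, with the second derivative estimated by
  \<open>second_derivative_bound\<close>.  Both kernels are written through the squared norm, which is a
  quadratic polynomial in the parameter.
\<close>

lemma kernel_taylor:
  fixes z\<^sub>0 z :: "real ^ 'n"
  assumes t: "0 \<le> t" and R: "0 < R"
    and seg: "\<And>v. v \<in> closed_segment z\<^sub>0 z \<Longrightarrow> R \<le> norm v"
  shows "\<bar>\<Phi> t z 0 - \<Phi> t z\<^sub>0 0 - kernel_gradient t z\<^sub>0 \<bullet> (z - z\<^sub>0)\<bar>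
           \<le> a_const t * (norm (z - z\<^sub>0))\<^sup>2 / (2 * R powr (t + 2))"
proof -
  define d where "d = z - z\<^sub>0"
  define v where "v = (\<lambda>u::real. z\<^sub>0 + u *\<^sub>R d)"
  define Q where "Q = (\<lambda>u. v u \<bullet> v u)"
  define L where "L = (\<lambda>u. v u \<bullet> d)"
  define D where "D = d \<bullet> d"
  define k where "k = kernel_slope t"
  define f0 where "f0 = (\<lambda>u. if t = 0 then ln (Q u) / 2 else Q u powr (- t / 2))"
  define f1 where "f1 = (\<lambda>u. k * L u * Q u powr (- t / 2 - 1))"
  define f2 where "f2 = (\<lambda>u. k * (D * Q u powr (- t / 2 - 1)
                               - (t + 2) * (L u)\<^sup>2 * Q u powr (- t / 2 - 2)))"
  have seg': "R \<le> norm (v u)" if "0 \<le> u" "u \<le> 1" for u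
  proof (rule seg)
    have "v u = (1 - u) *\<^sub>R z\<^sub>0 + u *\<^sub>R z"
      by (simp add: v_def d_def algebra_simps)
    then show "v u \<in> closed_segment z\<^sub>0 z" using that unfolding closed_segment_def by blast
  qed
  have Qbig: "R\<^sup>2 \<le> Q u" if "0 \<le> u" "u \<le> 1" for u
    using power_mono[OF seg'[OF that], of 2] R by (simp add: Q_def dot_square_norm)
  have Qpos: "0 < Q u" if "0 \<le> u" "u \<le> 1" for u
    using Qbig[OF that] R by (smt (verit) zero_less_power)
  have Qpoly: "Q = (\<lambda>u. z\<^sub>0 \<bullet> z\<^sub>0 + 2 * u * (z\<^sub>0 \<bullet> d) + u\<^sup>2 * D)"
    by (rule ext) (simp add: Q_def v_def D_def inner_add_left inner_add_right
        inner_commute power2_eq_square algebra_simps)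
  have Lpoly: "L = (\<lambda>u. z\<^sub>0 \<bullet> d + u * D)"
    by (rule ext) (simp add: L_def v_def D_def inner_add_left)
  have dQ: "(Q has_real_derivative 2 * L u) (at u)" for u
    unfolding Qpoly Lpoly by (auto intro!: derivative_eq_intros simp: algebra_simps)
  have dL: "(L has_real_derivative D) (at u)" for u
    unfolding Lpoly by (auto intro!: derivative_eq_intros)
  have powr_down: "Q u powr (r - 1) = Q u powr r / Q u" if "0 \<le> u" "u \<le> 1" for u r
    using Qpos[OF that] by (simp add: powr_diff)
  have df0: "(f0 has_real_derivative f1 u) (at u)" if "0 \<le> u" "u \<le> 1" for u
  proof (cases "t = 0")
    case True
    have "((\<lambda>u. ln (Q u) / 2) has_real_derivative L u / Q u) (at u)"
      using Qpos[OF that] by (auto intro!: derivative_eq_intros dQ simp: field_simps)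
    moreover have "L u / Q u = f1 u"
      using True Qpos[OF that] by (simp add: f1_def k_def kernel_slope_def powr_minus divide_simps)
    ultimately show ?thesis using True by (simp add: f0_def)
  next
    case False
    have "((\<lambda>u. Q u powr (- t / 2)) has_real_derivative
             (- t / 2) * Q u powr (- t / 2 - 1) * (2 * L u)) (at u)"
      using DERIV_fun_powr[OF dQ Qpos[OF that], of "- t / 2"] by simp
    then show ?thesis using False
      by (simp add: f0_def f1_def k_def kernel_slope_def algebra_simps)
  qed
  have df1: "(f1 has_real_derivative f2 u) (at u)" if "0 \<le> u" "u \<le> 1" for u
  proof -
    have *: "((\<lambda>u. Q u powr (- t / 2 - 1)) has_real_derivative
             (- t / 2 - 1) * Q u powr (- t / 2 - 2) * (2 * L u)) (at u)"
      using DERIV_fun_powr[OF dQ Qpos[OF that], of "- t / 2 - 1"] by (simp add: algebra_simps)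
    show ?thesis unfolding f1_def f2_def
      by (rule DERIV_cong[OF DERIV_mult[OF DERIV_cmult[OF dL] *]])
        (simp add: algebra_simps power2_eq_square)
  qed
  define diff where "diff = (\<lambda>m::nat. if m = 0 then f0 else if m = 1 then f1 else f2)"
  have "\<exists>\<xi>>0. \<xi> < 1 \<and> f0 1 = (\<Sum>m<2. diff m 0 / fact m * 1 ^ m) + diff 2 \<xi> / fact 2 * 1 ^ 2"
    by (rule Maclaurin) (auto simp: diff_def df0 df1 less_2_cases_iff)
  then obtain \<xi> where \<xi>: "0 < \<xi>" "\<xi> < 1" "f0 1 = f0 0 + f1 0 + f2 \<xi> / 2"
    by (auto simp: diff_def numeral_2_eq_2)
  have "(L \<xi>)\<^sup>2 \<le> Q \<xi> * D"
    unfolding L_def Q_def D_def by (rule Cauchy_Schwarz_ineq)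
  then have "\<bar>f2 \<xi>\<bar> \<le> a_const t * D / R powr (t + 2)"
    unfolding f2_def k_def using \<xi> t R Qbig[of \<xi>]
    by (intro second_derivative_bound) (auto simp: D_def)
  then have "\<bar>f0 1 - f0 0 - f1 0\<bar> \<le> a_const t * D / (2 * R powr (t + 2))"
    using \<xi>(3) by (simp add: abs_divide flip: divide_divide_eq_left)
  moreover have f0_eq: "f0 u = \<Phi> t (v u) 0" if "0 \<le> u" "u \<le> 1" for u
    using seg'[OF that] R
    by (auto simp: f0_def \<Phi>_def Q_def norm_powr_eq_square_powr dot_square_norm ln_realpow)
  moreover have "f1 0 = kernel_gradient t z\<^sub>0 \<bullet> d"
    by (simp add: f1_def kernel_gradient_def k_def norm_powr_eq_square_powr Q_def L_def v_def
        algebra_simps diff_divide_distrib)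
  ultimately show ?thesis
    using f0_eq[of 0] f0_eq[of 1] by (simp add: v_def d_def D_def dot_square_norm)
qed

section \<open>Integrals over product sets\<close>

lemma (in finite_measure) set_integrable_of_bounded:
  fixes f :: "'a \<Rightarrow> 'b::{banach, second_countable_topology}"
  assumes [measurable]: "S \<in> sets M" "f \<in> borel_measurable M"
    and bound: "\<And>x. x \<in> S \<Longrightarrow> norm (f x) \<le> K"
  shows "set_integrable M S f"
  unfolding set_integrable_def
  by (rule integrable_const_bound[of _ "\<bar>K\<bar>"])
    (auto split: split_indicator dest!: bound intro!: AE_I2)

lemma (in finite_measure) set_integral_const:
  fixes c :: real
  assumes "S \<in> sets M"
  shows "(LINT x:S|M. c) = measure M S * c"
  using assms by (simp add: set_lebesgue_integral_def emeasure_eq_measure)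

lemma (in pair_sigma_finite) set_integral_Times:
  fixes f :: "'a \<times> 'b \<Rightarrow> real"
  assumes "set_integrable (M1 \<Otimes>\<^sub>M M2) (B \<times> B') f"
  shows "(LINT z:B \<times> B'|(M1 \<Otimes>\<^sub>M M2). f z) = (LINT x:B|M1. LINT y:B'|M2. f (x, y))"
proof -
  have "(LINT z:B \<times> B'|(M1 \<Otimes>\<^sub>M M2). f z)
          = (LINT x|M1. LINT y|M2. indicator (B \<times> B') (x, y) *\<^sub>R f (x, y))"
    using assms unfolding set_integrable_def set_lebesgue_integral_def
    by (rule integral_fst'[symmetric])
  also have "\<dots> = (LINT x:B|M1. LINT y:B'|M2. f (x, y))"
    unfolding set_lebesgue_integral_def
    by (intro Bochner_Integration.integral_cong) (auto simp: indicator_times mult.assoc)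
  finally show ?thesis .
qed

lemma set_integral_UNION_Times:
  fixes f :: "'a \<times> 'b \<Rightarrow> real"
  assumes fin: "finite I" "finite I'"
    and disj: "disjoint_family_on B I" "disjoint_family_on B' I'"
    and sets: "\<And>i. i \<in> I \<Longrightarrow> B i \<in> sets M1" "\<And>i. i \<in> I' \<Longrightarrow> B' i \<in> sets M2"
    and int: "set_integrable (M1 \<Otimes>\<^sub>M M2) ((\<Union>i\<in>I. B i) \<times> (\<Union>i\<in>I'. B' i)) f"
  shows "(LINT z:(\<Union>i\<in>I. B i) \<times> (\<Union>i\<in>I'. B' i)|(M1 \<Otimes>\<^sub>M M2). f z)
           = (\<Sum>i\<in>I. \<Sum>i'\<in>I'. LINT z:B i \<times> B' i'|(M1 \<Otimes>\<^sub>M M2). f z)"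
proof -
  define C where "C = (\<lambda>(i, i'). B i \<times> B' i')"
  have U: "(\<Union>i\<in>I. B i) \<times> (\<Union>i\<in>I'. B' i) = (\<Union>j\<in>I \<times> I'. C j)"
    by (auto simp: C_def)
  have "(LINT z:(\<Union>j\<in>I \<times> I'. C j)|(M1 \<Otimes>\<^sub>M M2). f z)
          = (\<Sum>j\<in>I \<times> I'. LINT z:C j|(M1 \<Otimes>\<^sub>M M2). f z)"
  proof (rule set_integral_finite_Union)
    show "disjoint_family_on C (I \<times> I')"
      using disj by (fastforce simp: disjoint_family_on_def C_def)
    fix j assume j: "j \<in> I \<times> I'"
    show C: "C j \<in> sets (M1 \<Otimes>\<^sub>M M2)" using j sets by (auto simp: C_def)
    show "set_integrable (M1 \<Otimes>\<^sub>M M2) (C j) f"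
      by (rule set_integrable_subset[OF int C]) (use j in \<open>auto simp: U\<close>)
  qed (use fin in auto)
  then show ?thesis by (simp add: U C_def sum.cartesian_product split_def)
qed

section \<open>The barycentre rule on one pair of sets\<close>

text \<open>
  When \<open>B\<close> is null the barycentre has a default value, but then both sides vanish.
\<close>

lemma set_integral_eq_barycentre:
  assumes "finite_measure \<mu>" "sets \<mu> = sets borel" "B \<in> sets borel"
  shows "(LINT x:B|\<mu>. x) = measure \<mu> B *\<^sub>R barycentre \<mu> B"
proof (cases "measure \<mu> B = 0")
  case True
  interpret finite_measure \<mu> by fact
  have "AE x in \<mu>. x \<notin> B"
    using True assms by (auto intro!: AE_I[of _ _ B] simp: emeasure_eq_measure)
  then have "AE x in \<mu>. indicator B x *\<^sub>R x = 0" by (rule AE_mp) auto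
  then show ?thesis using True
    unfolding set_lebesgue_integral_def by (simp add: integral_eq_zero_AE)
qed (simp add: barycentre_def)

lemma set_integral_inner_barycentre:
  fixes B :: "(real ^ 'n) set"
  assumes "finite_measure \<mu>" "sets \<mu> = sets borel" "compact B"
  shows "set_integrable \<mu> B (\<lambda>x. u \<bullet> (x - barycentre \<mu> B))"
    and "(LINT x:B|\<mu>. u \<bullet> (x - barycentre \<mu> B)) = 0"
proof -
  interpret finite_measure \<mu> by fact
  note [measurable_cong] = assms(2)
  have B [measurable]: "B \<in> sets borel" using assms(3) by (intro borel_closed compact_imp_closed)
  obtain K where K: "\<And>x. x \<in> B \<Longrightarrow> norm x \<le> K"
    using compact_imp_bounded[OF assms(3)] by (auto simp: bounded_iff)
  have int: "set_integrable \<mu> B (\<lambda>x. x)"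
    by (rule set_integrable_of_bounded[of _ _ K]) (use K in auto)
  have c: "set_integrable \<mu> B (\<lambda>x. c)" for c :: real
    by (rule set_integrable_of_bounded[of _ _ "\<bar>c\<bar>"]) auto
  have iu: "set_integrable \<mu> B (\<lambda>x. u \<bullet> x)"
    using integrable_inner_right[OF int[unfolded set_integrable_def], of u]
    by (simp add: set_integrable_def)
  show "set_integrable \<mu> B (\<lambda>x. u \<bullet> (x - barycentre \<mu> B))"
    unfolding inner_diff_right by (intro set_integral_diff iu c)
  have "(LINT x:B|\<mu>. u \<bullet> (x - barycentre \<mu> B))
          = (LINT x:B|\<mu>. u \<bullet> x) - (LINT x:B|\<mu>. u \<bullet> barycentre \<mu> B)"
    unfolding inner_diff_right by (intro set_integral_diff iu c)
  also have "(LINT x:B|\<mu>. u \<bullet> x) = u \<bullet> (LINT x:B|\<mu>. x)"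
    using integral_inner_right[OF int[unfolded set_integrable_def], of u]
    by (simp add: set_lebesgue_integral_def)
  also have "\<dots> = u \<bullet> (measure \<mu> B *\<^sub>R barycentre \<mu> B)"
    by (simp add: set_integral_eq_barycentre assms)
  finally show "(LINT x:B|\<mu>. u \<bullet> (x - barycentre \<mu> B)) = 0"
    by (simp add: set_integral_const assms)
qed

text \<open>
  If \<open>f\<close> is within \<open>K\<close> of an affine function on \<open>B \<times> B'\<close>, then the rule that evaluates this affine
  function at the barycentres is off by at most \<open>K\<close> times the mass, because it integrates affine
  functions exactly.
\<close>

lemma barycentre_rule_error:
  fixes f :: "(real ^ 'n) \<times> (real ^ 'n) \<Rightarrow> real"
  assumes fin: "finite_measure \<mu>" "finite_measure \<mu>'"
    and sets: "sets \<mu> = sets borel" "sets \<mu>' = sets borel"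
    and comp: "compact B" "compact B'"
    and f: "f \<in> borel_measurable borel"
    and bound: "\<And>x y. x \<in> B \<Longrightarrow> y \<in> B' \<Longrightarrow>
      \<bar>f (x, y) - (c + u \<bullet> (x - barycentre \<mu> B) + v \<bullet> (y - barycentre \<mu>' B'))\<bar> \<le> K"
  shows "\<bar>(LINT z:B \<times> B'|(\<mu> \<Otimes>\<^sub>M \<mu>'). f z) - measure \<mu> B * measure \<mu>' B' * c\<bar>
           \<le> K * measure \<mu> B * measure \<mu>' B'"
proof -
  interpret X: finite_measure \<mu> by fact
  interpret Y: finite_measure \<mu>' by fact
  interpret P: pair_sigma_finite \<mu> \<mu>' ..
  interpret N: finite_measure "\<mu> \<Otimes>\<^sub>M \<mu>'" by (rule finite_measure_pair_measure[OF fin(2,1)])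
  let ?N = "\<mu> \<Otimes>\<^sub>M \<mu>'"
  note [measurable_cong] = sets
  have [measurable]: "B \<in> sets borel" "B' \<in> sets borel"
    using comp by (auto intro!: borel_closed compact_imp_closed)
  have f' [measurable]: "f \<in> borel_measurable (borel \<Otimes>\<^sub>M borel)" using f by (simp add: borel_prod)
  define G where "G = (\<lambda>z. c + u \<bullet> (fst z - barycentre \<mu> B) + v \<bullet> (snd z - barycentre \<mu>' B'))"
  have [measurable]: "G \<in> borel_measurable (borel \<Otimes>\<^sub>M borel)" unfolding G_def by measurable
  have "compact (G ` (B \<times> B'))"
    unfolding G_def by (intro compact_continuous_image compact_Times comp continuous_intros)
  then have "bounded (G ` (B \<times> B'))" by (rule compact_imp_bounded)
  then obtain KG where KG: "\<And>z. z \<in> B \<times> B' \<Longrightarrow> \<bar>G z\<bar> \<le> KG"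
    unfolding bounded_iff by (metis imageI real_norm_def)
  have iG: "set_integrable ?N (B \<times> B') G"
    by (rule N.set_integrable_of_bounded[of _ _ KG]) (use KG in auto)
  have iD: "set_integrable ?N (B \<times> B') (\<lambda>z. f z - G z)"
    by (rule N.set_integrable_of_bounded[of _ _ K]) (use bound in \<open>auto simp: G_def\<close>)
  have "(LINT z:B \<times> B'|?N. G z) = (LINT x:B|\<mu>. LINT y:B'|\<mu>'. G (x, y))"
    by (rule P.set_integral_Times[OF iG])
  also have "\<dots> = (LINT x:B|\<mu>. measure \<mu>' B' * (c + u \<bullet> (x - barycentre \<mu> B)))"
  proof (intro arg_cong[of _ _ "\<lambda>g. set_lebesgue_integral \<mu> B g"] ext)
    fix x
    have "(LINT y:B'|\<mu>'. (c + u \<bullet> (x - barycentre \<mu> B)) + v \<bullet> (y - barycentre \<mu>' B'))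
        = (LINT y:B'|\<mu>'. c + u \<bullet> (x - barycentre \<mu> B))
          + (LINT y:B'|\<mu>'. v \<bullet> (y - barycentre \<mu>' B'))"
      using fin(2) sets(2) comp(2)
      by (intro set_integral_add set_integral_inner_barycentre
          Y.set_integrable_of_bounded[of _ _ "\<bar>c + u \<bullet> (x - barycentre \<mu> B)\<bar>"]) auto
    then show "(LINT y:B'|\<mu>'. G (x, y)) = measure \<mu>' B' * (c + u \<bullet> (x - barycentre \<mu> B))"
      using fin(2) sets(2) comp(2)
      by (simp add: G_def set_integral_inner_barycentre Y.set_integral_const)
  qed
  also have "\<dots> = measure \<mu>' B' * (LINT x:B|\<mu>. c + u \<bullet> (x - barycentre \<mu> B))"
    by simp
  also have "(LINT x:B|\<mu>. c + u \<bullet> (x - barycentre \<mu> B))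
      = (LINT x:B|\<mu>. c) + (LINT x:B|\<mu>. u \<bullet> (x - barycentre \<mu> B))"
    using fin(1) sets(1) comp(1)
    by (intro set_integral_add set_integral_inner_barycentre
        X.set_integrable_of_bounded[of _ _ "\<bar>c\<bar>"]) auto
  also have "\<dots> = measure \<mu> B * c"
    using fin(1) sets(1) comp(1)
    by (simp add: set_integral_inner_barycentre X.set_integral_const)
  finally have G: "(LINT z:B \<times> B'|?N. G z) = measure \<mu> B * measure \<mu>' B' * c" by simp
  have "(LINT z:B \<times> B'|?N. f z) = (LINT z:B \<times> B'|?N. (f z - G z) + G z)" by simp
  also have "\<dots> = (LINT z:B \<times> B'|?N. f z - G z) + (LINT z:B \<times> B'|?N. G z)"
    by (intro set_integral_add iD iG)
  finally have "\<bar>(LINT z:B \<times> B'|?N. f z) - measure \<mu> B * measure \<mu>' B' * c\<bar>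
      = \<bar>LINT z:B \<times> B'|?N. f z - G z\<bar>" using G by simp
  also have "\<dots> \<le> (LINT z:B \<times> B'|?N. \<bar>f z - G z\<bar>)"
    using set_integral_norm_bound[OF iD] by simp
  also have "\<dots> \<le> (LINT z:B \<times> B'|?N. K)"
    by (intro set_integral_mono set_integrable_abs iD N.set_integrable_of_bounded[of _ _ "\<bar>K\<bar>"])
      (use bound in \<open>auto simp: G_def\<close>)
  also have "\<dots> = K * measure \<mu> B * measure \<mu>' B'"
  proof -
    have "measure ?N (B \<times> B') = measure \<mu> B * measure \<mu>' B'"
      unfolding measure_def by (simp add: Y.emeasure_pair_measure_Times enn2real_mult)
    then show ?thesis by (simp add: N.set_integral_const)
  qed
  finally show ?thesis .
qed

text \<open>
  Balls are convex: a ball of radius \<open>d\<close> about a point of \<open>S\<close> contains the hull, and therefore so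
  does a ball of radius \<open>d\<close> about a point of the hull.
\<close>

lemma dist_convex_hull_le:
  fixes S :: "'a::real_normed_vector set"
  assumes "x \<in> convex hull S" "y \<in> convex hull S" and S: "\<And>a b. a \<in> S \<Longrightarrow> b \<in> S \<Longrightarrow> dist a b \<le> d"
  shows "dist x y \<le> d"
proof -
  have 1: "convex hull S \<subseteq> cball a d" if "a \<in> S" for a
    using that S by (intro hull_minimal convex_cball) (auto simp: mem_cball)
  have "convex hull S \<subseteq> cball x d"
    using 1 assms(1) by (intro hull_minimal convex_cball) (auto simp: mem_cball dist_commute subset_eq)
  then show ?thesis using assms(2) by auto
qed

text \<open>
  Otherwise a hyperplane strictly separates the barycentre from the hull, and the corresponding
  linear functional, centred at the barycentre, is bounded below by a positive number on \<open>B\<close>.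
  This contradicts that its integral over \<open>B\<close> is zero.
\<close>

lemma barycentre_in_convex_hull:
  fixes B :: "(real ^ 'n) set"
  assumes "finite_measure \<mu>" "sets \<mu> = sets borel" "compact B" "0 < measure \<mu> B"
  shows "barycentre \<mu> B \<in> convex hull B"
proof (rule ccontr)
  interpret finite_measure \<mu> by fact
  assume "barycentre \<mu> B \<notin> convex hull B"
  then obtain a \<beta> where a: "a \<bullet> barycentre \<mu> B < \<beta>" "\<And>x. x \<in> B \<Longrightarrow> \<beta> < a \<bullet> x"
    using separating_hyperplane_closed_point[OF convex_convex_hull
        compact_imp_closed[OF compact_convex_hull[OF assms(3)]]] hull_inc by metis
  define \<epsilon> where "\<epsilon> = \<beta> - a \<bullet> barycentre \<mu> B"
  have B: "B \<in> sets \<mu>" unfolding assms(2) by (intro borel_closed compact_imp_closed assms(3))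
  have "measure \<mu> B * \<epsilon> = (LINT x:B|\<mu>. \<epsilon>)"
    by (simp add: set_integral_const[OF B])
  also have "\<dots> \<le> (LINT x:B|\<mu>. a \<bullet> (x - barycentre \<mu> B))"
  proof (rule set_integral_mono)
    show "set_integrable \<mu> B (\<lambda>_. \<epsilon>)"
      by (rule set_integrable_of_bounded[of _ _ "\<bar>\<epsilon>\<bar>"]) (use B in auto)
    show "set_integrable \<mu> B (\<lambda>x. a \<bullet> (x - barycentre \<mu> B))"
      by (rule set_integral_inner_barycentre[OF assms(1-3)])
    show "\<epsilon> \<le> a \<bullet> (x - barycentre \<mu> B)" if "x \<in> B" for x
      using a(2)[OF that] by (simp add: \<epsilon>_def inner_diff_right)
  qed
  also have "\<dots> = 0" by (rule set_integral_inner_barycentre[OF assms(1-3)])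
  finally show False using a(1) assms(4) by (simp add: \<epsilon>_def mult_le_0_iff)
qed

text \<open>
  Apply \<open>kernel_taylor\<close> to the differences \<open>z\<^sub>0 = b - b'\<close> of the barycentres and \<open>z = x - y\<close>.  The
  segment between them consists of differences of points of the two convex hulls, so it keeps the
  distance \<open>R\<close> from the origin; its length is at most \<open>2 * h\<close>.
\<close>

lemma kernel_barycentre_error:
  fixes B B' :: "(real ^ 'n) set"
  assumes fin: "finite_measure \<mu>" "finite_measure \<mu>'"
    and sets: "sets \<mu> = sets borel" "sets \<mu>' = sets borel"
    and comp: "compact B" "compact B'"
    and pos: "0 < measure \<mu> B" "0 < measure \<mu>' B'"
    and diam: "diameter B \<le> h" "diameter B' \<le> h"
    and t: "0 \<le> t" and R: "0 < R" "R \<le> setdist (convex hull B) (convex hull B')"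
  shows "\<bar>(LINT z:B \<times> B'|(\<mu> \<Otimes>\<^sub>M \<mu>'). \<Phi> t (fst z) (snd z))
            - measure \<mu> B * measure \<mu>' B' * \<Phi> t (barycentre \<mu> B) (barycentre \<mu>' B')\<bar>
           \<le> 2 * a_const t * h\<^sup>2 / R powr (t + 2) * measure \<mu> B * measure \<mu>' B'"
proof (rule barycentre_rule_error[OF fin sets comp kernel_borel])
  define b where "b = barycentre \<mu> B"
  define b' where "b' = barycentre \<mu>' B'"
  have b: "b \<in> convex hull B" and b': "b' \<in> convex hull B'"
    unfolding b_def b'_def using assms by (auto intro: barycentre_in_convex_hull)
  fix x y assume "x \<in> B" "y \<in> B'"
  then have x: "x \<in> convex hull B" and y: "y \<in> convex hull B'"
    by (auto intro: hull_inc)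
  have "dist x b \<le> h"
    using order_trans[OF diameter_bounded_bound[OF compact_imp_bounded[OF comp(1)]] diam(1)]
    by (intro dist_convex_hull_le[OF x b])
  moreover have "dist y b' \<le> h"
    using order_trans[OF diameter_bounded_bound[OF compact_imp_bounded[OF comp(2)]] diam(2)]
    by (intro dist_convex_hull_le[OF y b'])
  moreover have "norm ((x - y) - (b - b')) \<le> dist x b + dist y b'"
    using norm_triangle_ineq4[of "x - b" "y - b'"] by (simp add: dist_norm algebra_simps)
  ultimately have "norm ((x - y) - (b - b')) \<le> 2 * h" by linarith
  then have sq: "(norm ((x - y) - (b - b')))\<^sup>2 \<le> (2 * h)\<^sup>2"
    by (intro power_mono) auto
  have seg: "R \<le> norm v" if v: "v \<in> closed_segment (b - b') (x - y)" for v
  proof -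
    obtain u where u: "0 \<le> u" "u \<le> 1" "v = (1 - u) *\<^sub>R (b - b') + u *\<^sub>R (x - y)"
      using v by (auto simp: closed_segment_def)
    have "(1 - u) *\<^sub>R b + u *\<^sub>R x \<in> convex hull B" "(1 - u) *\<^sub>R b' + u *\<^sub>R y \<in> convex hull B'"
      using u b b' x y by (auto intro!: convexD)
    then have "R \<le> dist ((1 - u) *\<^sub>R b + u *\<^sub>R x) ((1 - u) *\<^sub>R b' + u *\<^sub>R y)"
      using R(2) setdist_le_dist order_trans by blast
    also have "\<dots> = norm v" by (simp add: u dist_norm algebra_simps)
    finally show ?thesis .
  qed
  have shift: "\<Phi> t v w = \<Phi> t (v - w) 0" for v w :: "real ^ 'n" by (simp add: \<Phi>_def)
  let ?g = "kernel_gradient t (b - b')"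
  have "\<bar>\<Phi> t x y - \<Phi> t b b' - ?g \<bullet> ((x - y) - (b - b'))\<bar>
      \<le> a_const t * (norm ((x - y) - (b - b')))\<^sup>2 / (2 * R powr (t + 2))"
    unfolding shift[of x y] shift[of b b'] by (rule kernel_taylor[OF t R(1) seg])
  also have "\<dots> \<le> a_const t * (2 * h)\<^sup>2 / (2 * R powr (t + 2))"
    using a_const_nonneg[OF t] sq by (intro divide_right_mono mult_left_mono) auto
  also have "\<dots> = 2 * a_const t * h\<^sup>2 / R powr (t + 2)"
    by (simp add: power2_eq_square field_simps)
  finally show "\<bar>\<Phi> t (fst (x, y)) (snd (x, y)) - (\<Phi> t (barycentre \<mu> B) (barycentre \<mu>' B')
      + ?g \<bullet> (x - barycentre \<mu> B) + (- ?g) \<bullet> (y - barycentre \<mu>' B'))\<bar>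
      \<le> 2 * a_const t * h\<^sup>2 / R powr (t + 2)"
    by (simp add: b_def b'_def inner_diff_right algebra_simps)
qed

section \<open>Pieces of a self-similar set\<close>

locale disjoint_ifs =
  fixes M :: nat
    and \<rho> :: "nat \<Rightarrow> real"
    and A :: "nat \<Rightarrow> real ^ 'n ^ 'n"
    and \<delta> :: "nat \<Rightarrow> real ^ 'n"
    and s :: "nat \<Rightarrow> real ^ 'n \<Rightarrow> real ^ 'n"
    and \<Gamma> :: "(real ^ 'n) set"
  assumes ifs: "similarity_ifs M \<rho> A \<delta> s"
    and attractor: "is_attractor M s \<Gamma>"
    and disjoint: "disjoint_attractor M s \<Gamma>"
begin

lemma M_ge_2: "2 \<le> M"
  using ifs by (simp add: similarity_ifs_def)

lemma ratio: "m \<in> {1..M} \<Longrightarrow> 0 < \<rho> m" "m \<in> {1..M} \<Longrightarrow> \<rho> m < 1"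
  using ifs by (auto simp: similarity_ifs_def)

lemma map_eq: "m \<in> {1..M} \<Longrightarrow> s m = (\<lambda>x. \<rho> m *\<^sub>R (A m *v x) + \<delta> m)"
  using ifs by (auto simp: similarity_ifs_def)

lemma norm_map_diff:
  assumes "m \<in> {1..M}"
  shows "norm (s m x - s m y) = \<rho> m * norm (x - y)"
proof -
  have "orthogonal_transformation ((*v) (A m))"
    using ifs assms by (auto simp: similarity_ifs_def orthogonal_transformation_matrix)
  then have "norm (A m *v (x - y)) = norm (x - y)"
    by (rule orthogonal_transformation_norm)
  moreover have "s m x - s m y = \<rho> m *\<^sub>R (A m *v (x - y))"
    using assms by (simp add: map_eq matrix_vector_mult_diff_distrib scaleR_diff_right)
  ultimately show ?thesis using ratio(1)[OF assms] by simp
qed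

lemma inj_map: "m \<in> {1..M} \<Longrightarrow> inj (s m)"
  by (rule injI) (metis norm_map_diff ratio(1) mult_eq_0_iff norm_eq_zero order_less_irrefl right_minus_eq)

lemma continuous_map: "m \<in> {1..M} \<Longrightarrow> continuous_on S (s m)"
  by (simp add: map_eq) (intro continuous_intros linear_continuous_on matrix_vector_mul_bounded_linear)

lemma map_convex_hull:
  assumes "m \<in> {1..M}"
  shows "convex hull (s m ` S) = s m ` (convex hull S)"
proof -
  have 1: "s m ` S = (+) (\<delta> m) ` (\<lambda>x. \<rho> m *\<^sub>R (A m *v x)) ` S" for S
    using assms by (auto simp: map_eq image_image add.commute)
  have 2: "linear (\<lambda>x. \<rho> m *\<^sub>R (A m *v x))"
    by (intro linear_compose_scale_right matrix_vector_mul_linear)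
  show ?thesis unfolding 1 convex_hull_translation convex_hull_linear_image[OF 2] ..
qed

lemma \<Gamma>_nonempty: "\<Gamma> \<noteq> {}" and compact_\<Gamma>: "compact \<Gamma>"
  using attractor by (auto simp: is_attractor_def)

lemma \<Gamma>_eq: "\<Gamma> = (\<Union>m\<in>{1..M}. s m ` \<Gamma>)"
  using attractor by (simp add: is_attractor_def)

lemma map_in_\<Gamma>: "m \<in> {1..M} \<Longrightarrow> x \<in> \<Gamma> \<Longrightarrow> s m x \<in> \<Gamma>"
  using \<Gamma>_eq by blast

lemma finite_pairs: "finite {f m m' | m m'. m \<in> {1..M} \<and> m' \<in> {1..M} \<and> m \<noteq> m'}"
  by (rule finite_subset[of _ "(\<lambda>(m, m'). f m m') ` ({1..M} \<times> {1..M})"]) auto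

lemma disjoint_images:
  assumes "m \<in> {1..M}" "m' \<in> {1..M}" "m \<noteq> m'"
  shows "s m ` \<Gamma> \<inter> s m' ` \<Gamma> = {}"
proof (rule ccontr)
  assume "\<not> ?thesis"
  then have "setdist (s m ` \<Gamma>) (s m' ` \<Gamma>) = 0"
    by (meson disjoint_iff setdist_eq_0I)
  moreover have "0 < setdist (s m ` \<Gamma>) (s m' ` \<Gamma>)"
    using disjoint assms unfolding disjoint_attractor_def
    by (subst (asm) Min_gr_iff[OF finite_pairs]) blast+
  ultimately show False by simp
qed

lemma piece_Nil [simp]: "piece s \<Gamma> [] = \<Gamma>"
  by (simp add: piece_def)

lemma piece_Cons: "piece s \<Gamma> (m # w) = s m ` piece s \<Gamma> w"
  by (simp add: piece_def image_image)

lemma piece_append: "piece s \<Gamma> (w @ v) = foldr s w ` piece s \<Gamma> v"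
  by (simp add: piece_def image_image)

lemma piece_nonempty: "piece s \<Gamma> w \<noteq> {}"
  by (simp add: piece_def \<Gamma>_nonempty)

lemma compact_piece: "set w \<subseteq> {1..M} \<Longrightarrow> compact (piece s \<Gamma> w)"
  by (induction w) (auto simp: piece_Cons compact_\<Gamma> intro!: compact_continuous_image continuous_map)

lemma piece_subset_\<Gamma>: "set w \<subseteq> {1..M} \<Longrightarrow> piece s \<Gamma> w \<subseteq> \<Gamma>"
  by (induction w) (auto simp: piece_Cons map_in_\<Gamma>)

lemma piece_append_subset: "set v \<subseteq> {1..M} \<Longrightarrow> piece s \<Gamma> (w @ v) \<subseteq> piece s \<Gamma> w"
  unfolding piece_append using piece_subset_\<Gamma>[of v] by (auto simp: piece_def)

lemma diameter_piece_mono: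
  assumes "set w \<subseteq> {1..M}" "set v \<subseteq> {1..M}"
  shows "diameter (piece s \<Gamma> (w @ v)) \<le> diameter (piece s \<Gamma> w)"
  using assms by (intro diameter_subset piece_append_subset compact_imp_bounded compact_piece)

lemma piece_split: "piece s \<Gamma> w = (\<Union>m\<in>{1..M}. piece s \<Gamma> (w @ [m]))"
  unfolding piece_append by (subst (1) piece_def, subst \<Gamma>_eq) (auto simp: piece_Cons)

lemma inj_foldr_maps: "set w \<subseteq> {1..M} \<Longrightarrow> inj (foldr s w)"
  by (induction w) (auto intro!: inj_compose inj_map simp: id_def[symmetric])

lemma disjoint_pieces:
  assumes "set w \<subseteq> {1..M}" "set (m # v) \<subseteq> {1..M}" "set (m' # v') \<subseteq> {1..M}" "m \<noteq> m'"
  shows "piece s \<Gamma> (w @ m # v) \<inter> piece s \<Gamma> (w @ m' # v') = {}"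
proof -
  have "piece s \<Gamma> (m # v) \<inter> piece s \<Gamma> (m' # v') = {}"
    using disjoint_images[of m m'] piece_subset_\<Gamma>[of v] piece_subset_\<Gamma>[of v'] assms
    by (fastforce simp: piece_Cons)
  then show ?thesis
    unfolding piece_append using image_Int[OF inj_foldr_maps[OF assms(1)]] by (metis image_empty)
qed

section \<open>The partition of a piece into pieces of diameter at most h\<close>

text \<open>
  The diameter of a piece decays geometrically in the length of the word, with the largest of the
  finitely many contraction ratios as the rate.
\<close>

lemma small_diameter_of_long_words:
  assumes "0 < h"
  obtains N where "\<And>w. set w \<subseteq> {1..M} \<Longrightarrow> N \<le> length w \<Longrightarrow> diameter (piece s \<Gamma> w) \<le> h"
proof -
  define q where "q = Max (\<rho> ` {1..M})"
  have ne: "{1..M} \<noteq> {}" using M_ge_2 by auto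
  have q_ge: "\<rho> m \<le> q" if "m \<in> {1..M}" for m
    unfolding q_def using that by (intro Max_ge) auto
  have q: "0 < q" "q < 1"
  proof -
    show "0 < q" using q_ge[of 1] ratio(1)[of 1] M_ge_2 by simp
    show "q < 1" using ne ratio(2) unfolding q_def by (subst Max_less_iff) auto
  qed
  have diam0: "0 \<le> diameter \<Gamma>"
    by (intro diameter_ge_0 compact_imp_bounded compact_\<Gamma>)
  have bound: "diameter (piece s \<Gamma> w) \<le> q ^ length w * diameter \<Gamma>" if "set w \<subseteq> {1..M}" for w
    using that
  proof (induction w)
    case (Cons m w)
    then have m: "m \<in> {1..M}" and w: "set w \<subseteq> {1..M}" by auto
    have "diameter (piece s \<Gamma> (m # w)) \<le> \<rho> m * diameter (piece s \<Gamma> w)"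
    proof (rule diameter_le)
      fix x y assume "x \<in> piece s \<Gamma> (m # w)" "y \<in> piece s \<Gamma> (m # w)"
      then obtain x' y' where *: "x = s m x'" "y = s m y'" "x' \<in> piece s \<Gamma> w" "y' \<in> piece s \<Gamma> w"
        by (auto simp: piece_Cons)
      have "dist x' y' \<le> diameter (piece s \<Gamma> w)"
        by (rule diameter_bounded_bound) (use * w compact_piece compact_imp_bounded in auto)
      then show "norm (x - y) \<le> \<rho> m * diameter (piece s \<Gamma> w)"
        unfolding * norm_map_diff[OF m] using ratio[OF m] by (simp add: dist_norm)
    qed (simp add: piece_nonempty)
    also have "\<dots> \<le> q * (q ^ length w * diameter \<Gamma>)"
      using q_ge[OF m] ratio[OF m] q Cons.IH[OF w]
      by (intro mult_mono) (auto intro!: diameter_ge_0 compact_imp_bounded compact_piece w)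
    finally show ?case by simp
  qed simp
  have "(\<lambda>k. q ^ k * diameter \<Gamma>) \<longlonglongrightarrow> 0"
    using LIMSEQ_realpow_zero[of q] q by (auto intro!: tendsto_mult_left_zero)
  then have "\<forall>\<^sub>F k in sequentially. q ^ k * diameter \<Gamma> < h"
    using assms by (rule order_tendstoD)
  then obtain N where N: "\<And>k. N \<le> k \<Longrightarrow> q ^ k * diameter \<Gamma> < h"
    by (auto simp: eventually_sequentially)
  show thesis using that[of N] bound N by (meson less_imp_le order_trans)
qed

lemma L_index_word: "v \<in> L_index M s \<Gamma> h w \<Longrightarrow> set v \<subseteq> {1..M}"
  by (auto simp: L_index_def split: if_splits)

lemma L_index_diameter: "v \<in> L_index M s \<Gamma> h w \<Longrightarrow> diameter (piece s \<Gamma> (w @ v)) \<le> h"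
  by (auto simp: L_index_def split: if_splits)

lemma finite_L_index:
  assumes "0 < h" "set w \<subseteq> {1..M}"
  shows "finite (L_index M s \<Gamma> h w)"
proof -
  obtain N where N: "\<And>w. set w \<subseteq> {1..M} \<Longrightarrow> N \<le> length w \<Longrightarrow> diameter (piece s \<Gamma> w) \<le> h"
    using small_diameter_of_long_words[OF assms(1)] by blast
  have "length v \<le> N" if "v \<in> L_index M s \<Gamma> h w" for v
  proof (rule ccontr)
    assume *: "\<not> length v \<le> N"
    then have v: "v \<noteq> []" "N \<le> length (butlast v)" by auto
    with that have "\<not> diameter (piece s \<Gamma> (w @ butlast v)) \<le> h"
      by (auto simp: L_index_def split: if_splits)
    moreover have "set (butlast v) \<subseteq> {1..M}"
      using L_index_word[OF that] by (meson in_set_butlastD subset_code(1))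
    ultimately show False using N[of "w @ butlast v"] v(2) assms(2) by force
  qed
  then have "L_index M s \<Gamma> h w \<subseteq> {v. set v \<subseteq> {1..M} \<and> length v \<le> N}"
    using L_index_word by blast
  then show ?thesis
    using finite_lists_length_le[of "{1..M}" N] finite_subset by auto
qed

text \<open>
  The convention that the index set of a small piece is \<open>{[]}\<close> makes this hold also if the first-level
  piece has diameter at most \<open>h\<close>: then both sides hold for \<open>v = []\<close> only.
\<close>

lemma L_index_Cons:
  assumes "m \<in> {1..M}" "h < diameter \<Gamma>"
  shows "m # v \<in> L_index M s \<Gamma> h [] \<longleftrightarrow> v \<in> L_index M s \<Gamma> h [m]"
proof (cases "v = []")
  case True
  with assms show ?thesis by (auto simp: L_index_def)
next
  case False
  have "diameter (piece s \<Gamma> (m # butlast v)) \<le> diameter (piece s \<Gamma> [m])" if "set v \<subseteq> {1..M}"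
    using diameter_piece_mono[of "[m]" "butlast v"] that assms(1)
    by (simp add: subset_iff) (meson in_set_butlastD)
  moreover have "\<not> set v \<subseteq> {1..M} \<Longrightarrow> v \<notin> L_index M s \<Gamma> h [m]" using L_index_word by blast
  ultimately show ?thesis using False assms unfolding L_index_def by force
qed

text \<open>
  Follow the address of \<open>x\<close>, one letter at a time, until the piece is small.  This stops, since
  sufficiently long words have small pieces.
\<close>

lemma pieces_cover:
  assumes "0 < h" "set w \<subseteq> {1..M}" "x \<in> piece s \<Gamma> w"
  shows "\<exists>v\<in>L_index M s \<Gamma> h w. x \<in> piece s \<Gamma> (w @ v)"
proof -
  obtain N where N: "\<And>w. set w \<subseteq> {1..M} \<Longrightarrow> N \<le> length w \<Longrightarrow> diameter (piece s \<Gamma> w) \<le> h"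
    using small_diameter_of_long_words[OF assms(1)] by blast
  show ?thesis using assms(2,3)
  proof (induction "N - length w" arbitrary: w rule: less_induct)
    case less
    show ?case
    proof (cases "h < diameter (piece s \<Gamma> w)")
      case False
      then show ?thesis using less.prems by (simp add: L_index_def)
    next
      case True
      then have len: "length w < N" using N[OF less.prems(1)] by force
      obtain m where m: "m \<in> {1..M}" "x \<in> piece s \<Gamma> (w @ [m])"
        using less.prems(2) piece_split by blast
      obtain v where v: "v \<in> L_index M s \<Gamma> h (w @ [m])" "x \<in> piece s \<Gamma> ((w @ [m]) @ v)"
      proof -
        have "N - length (w @ [m]) < N - length w" using len by simp
        then show ?thesis using less.hyps[of "w @ [m]"] less.prems m that by auto
      qed
      have "m # v \<in> L_index M s \<Gamma> h w"
        using True v(1) m(1) by (auto simp: L_index_def split: if_splits)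
      then show ?thesis using v(2) by (intro bexI[of _ "m # v"]) auto
    qed
  qed
qed

lemma UN_pieces:
  assumes "0 < h" "set w \<subseteq> {1..M}"
  shows "(\<Union>v\<in>L_index M s \<Gamma> h w. piece s \<Gamma> (w @ v)) = piece s \<Gamma> w"
proof
  show "(\<Union>v\<in>L_index M s \<Gamma> h w. piece s \<Gamma> (w @ v)) \<subseteq> piece s \<Gamma> w"
    by (intro UN_least piece_append_subset L_index_word)
  show "piece s \<Gamma> w \<subseteq> (\<Union>v\<in>L_index M s \<Gamma> h w. piece s \<Gamma> (w @ v))"
    using pieces_cover[OF assms] by (intro subsetI) (simp add: UN_iff)
qed

text \<open>
  A piece is indexed by the first word along an address whose piece is small, so a proper extension
  of such a word cannot occur: its predecessor is already small.
\<close>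

lemma L_index_prefix_free:
  assumes "v \<in> L_index M s \<Gamma> h w" "v @ u \<in> L_index M s \<Gamma> h w" "set w \<subseteq> {1..M}"
  shows "u = []"
proof (rule ccontr)
  assume u: "u \<noteq> []"
  with assms have "h < diameter (piece s \<Gamma> (w @ v @ butlast u))"
    by (auto simp: L_index_def butlast_append split: if_splits)
  also have "\<dots> \<le> diameter (piece s \<Gamma> (w @ v))"
    using diameter_piece_mono[of "w @ v" "butlast u"] assms(3) L_index_word[OF assms(2)]
    by (simp add: subset_iff) (meson in_set_butlastD)
  finally show False using L_index_diameter[OF assms(1)] by simp
qed

text \<open>
  Two distinct words of a prefix-free set have different letters at some position after a common
  prefix, and the images of \<open>\<Gamma>\<close> under different maps are disjoint.
\<close>

lemma L_index_disjoint:
  assumes "v \<in> L_index M s \<Gamma> h w" "v' \<in> L_index M s \<Gamma> h w" "v \<noteq> v'" "set w \<subseteq> {1..M}"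
  shows "piece s \<Gamma> (w @ v) \<inter> piece s \<Gamma> (w @ v') = {}"
proof -
  have "\<not> prefix v v'" "\<not> prefix v' v"
    using L_index_prefix_free[of v h w] L_index_prefix_free[of v' h w] assms
    by (auto simp: prefix_def)
  then obtain u a b c d where *: "a \<noteq> c" "v = u @ a # b" "v' = u @ c # d"
    using parallel_decomp[of v v'] by (auto simp: parallel_def)
  show ?thesis
    using disjoint_pieces[of "w @ u" a b c d] * assms(4)
      L_index_word[OF assms(1)] L_index_word[OF assms(2)] by simp
qed

end

section \<open>Self-similarity of the measures\<close>

context disjoint_ifs begin

lemma map_borel [measurable]: "m \<in> {1..M} \<Longrightarrow> s m \<in> borel_measurable borel"
  by (intro borel_measurable_continuous_onI continuous_map)

lemma piece_borel: "set w \<subseteq> {1..M} \<Longrightarrow> piece s \<Gamma> w \<in> sets borel"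
  by (intro borel_closed compact_imp_closed compact_piece)

lemma \<Gamma>_borel [measurable]: "\<Gamma> \<in> sets borel"
  by (intro borel_closed compact_imp_closed compact_\<Gamma>)

lemma image_\<Gamma>_borel [measurable]: "m \<in> {1..M} \<Longrightarrow> s m ` \<Gamma> \<in> sets borel"
  using piece_borel[of "[m]"] by (simp add: piece_Cons)

end

locale invariant_ifs_measure = disjoint_ifs M \<rho> A \<delta> s \<Gamma>
  for M \<rho> and A :: "nat \<Rightarrow> real ^ 'n ^ 'n" and \<delta> s \<Gamma> +
  fixes p :: "nat \<Rightarrow> real" and \<mu> :: "(real ^ 'n) measure"
  assumes invariant: "invariant_measure M s \<Gamma> p \<mu>"
begin

lemma weight: "m \<in> {1..M} \<Longrightarrow> 0 < p m" "m \<in> {1..M} \<Longrightarrow> p m < 1" "(\<Sum>m=1..M. p m) = 1"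
  using invariant by (auto simp: invariant_measure_def)

lemma sets_eq_borel [measurable_cong]: "sets \<mu> = sets borel"
  using invariant by (simp add: invariant_measure_def)

lemma space_eq_UNIV [simp]: "space \<mu> = UNIV"
  using sets_eq_imp_space_eq[OF sets_eq_borel] by simp

sublocale finite_measure \<mu>
  using invariant by (simp add: invariant_measure_def)

lemma null_outside: "B \<in> sets borel \<Longrightarrow> B \<inter> \<Gamma> = {} \<Longrightarrow> measure \<mu> B = 0"
proof -
  assume B: "B \<in> sets borel" "B \<inter> \<Gamma> = {}"
  have "measure \<mu> B \<le> measure \<mu> (- \<Gamma>)"
    using B by (intro finite_measure_mono) auto
  also have "\<dots> = 0" using invariant by (simp add: invariant_measure_def)
  finally show ?thesis by (simp add: measure_le_0_iff)
qed

lemma invariance: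
  "B \<in> sets borel \<Longrightarrow> measure \<mu> B = (\<Sum>m=1..M. p m * measure \<mu> (s m -` B))"
  using invariant by (auto simp: invariant_measure_def)

lemma vimage_borel: "m \<in> {1..M} \<Longrightarrow> B \<in> sets borel \<Longrightarrow> s m -` B \<in> sets borel"
  using measurable_sets[OF map_borel] by simp

text \<open>
  In the invariance equation only the term with index \<open>m\<close> survives: for \<open>k \<noteq> m\<close> the preimage of
  \<open>B\<close> under \<open>s k\<close> misses \<open>\<Gamma>\<close>, as the images of \<open>\<Gamma>\<close> are disjoint.
\<close>

lemma measure_in_image:
  assumes m: "m \<in> {1..M}" and B [measurable]: "B \<in> sets borel" and sub: "B \<subseteq> s m ` \<Gamma>"
  shows "measure \<mu> B = p m * measure \<mu> (s m -` B)"
proof -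
  have "measure \<mu> (s k -` B) = 0" if "k \<in> {1..M}" "k \<noteq> m" for k
  proof (rule null_outside)
    show "s k -` B \<in> sets borel" using that by (intro vimage_borel B)
    show "s k -` B \<inter> \<Gamma> = {}" using disjoint_images[OF that(1) m that(2)] sub by auto
  qed
  then have "(\<Sum>k=1..M. p k * measure \<mu> (s k -` B)) = (\<Sum>k\<in>{m}. p k * measure \<mu> (s k -` B))"
    using m by (intro sum.mono_neutral_right) auto
  then show ?thesis by (simp add: invariance)
qed

text \<open>
  \<open>measure_in_image\<close> identifies two measures, and integration against them yields the formula.
  The formula extends to non-integrable \<open>g\<close>, for which both Bochner integrals are zero.
\<close>

lemma image_integral:
  fixes g :: "real ^ 'n \<Rightarrow> real"
  assumes m: "m \<in> {1..M}" and [measurable]: "g \<in> borel_measurable borel"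
  shows "(LINT x:s m ` \<Gamma>|\<mu>. g x) = p m * (LINT x:\<Gamma>|\<mu>. g (s m x))"
proof -
  note [measurable] = map_borel[OF m] image_\<Gamma>_borel[OF m]
  define N1 where "N1 = density \<mu> (indicator (s m ` \<Gamma>))"
  define N2 where "N2 = density (distr (density \<mu> (indicator \<Gamma>)) borel (s m)) (\<lambda>_. ennreal (p m))"
  have "N1 = N2"
  proof (rule measure_eqI)
    fix B assume "B \<in> sets N1"
    then have B [measurable]: "B \<in> sets borel" by (simp add: N1_def sets_eq_borel)
    have vB [measurable]: "s m -` B \<in> sets borel" by (intro vimage_borel m B)
    have "emeasure N1 B = ennreal (measure \<mu> (s m ` \<Gamma> \<inter> B))"
      by (simp add: N1_def emeasure_density emeasure_eq_measure nn_integral_indicator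
          indicator_inter_arith[symmetric])
    also have "measure \<mu> (s m ` \<Gamma> \<inter> B) = p m * measure \<mu> (s m -` (s m ` \<Gamma> \<inter> B))"
      by (intro measure_in_image m) auto
    also have "s m -` (s m ` \<Gamma> \<inter> B) = \<Gamma> \<inter> s m -` B"
      using inj_map[OF m] by (auto dest: injD)
    also have "ennreal (p m * measure \<mu> (\<Gamma> \<inter> s m -` B)) = emeasure N2 B"
      using weight(1)[OF m]
      by (simp add: N2_def emeasure_density_const emeasure_distr emeasure_density ennreal_mult
          emeasure_eq_measure nn_integral_indicator indicator_inter_arith[symmetric])
    finally show "emeasure N1 B = emeasure N2 B" .
  qed (simp add: N1_def N2_def sets_eq_borel)
  have "(LINT x:s m ` \<Gamma>|\<mu>. g x) = integral\<^sup>L N1 g"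
    unfolding N1_def set_lebesgue_integral_def ennreal_indicator[symmetric]
    by (subst integral_density) auto
  also have "\<dots> = p m * (LINT x:\<Gamma>|\<mu>. g (s m x))"
    unfolding \<open>N1 = N2\<close> N2_def set_lebesgue_integral_def ennreal_indicator[symmetric]
    using weight(1)[OF m]
    by (subst integral_density) (auto simp: integral_distr integral_density)
  finally show ?thesis .
qed

text \<open>
  A point of \<open>\<Gamma>\<close> has at most \<open>Max (p ` {1..M})\<close> times the mass of its preimage point.  Iterating
  this bounds its mass by a null sequence.
\<close>

lemma singleton_null: "measure \<mu> {x} = 0"
proof -
  define q where "q = Max (p ` {1..M})"
  have ne: "{1..M} \<noteq> {}" using M_ge_2 by auto
  have q_ge: "p m \<le> q" if "m \<in> {1..M}" for m
    unfolding q_def using that by (intro Max_ge) auto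
  have q: "0 < q" "q < 1"
  proof -
    show "0 < q" using q_ge[of 1] weight(1)[of 1] M_ge_2 by simp
    show "q < 1" using ne weight(2) unfolding q_def by (subst Max_less_iff) auto
  qed
  have bound: "measure \<mu> {x} \<le> q ^ k * measure \<mu> UNIV" for k x
  proof (induction k arbitrary: x)
    case 0
    show ?case by (simp add: bounded_measure[of "{x}", simplified])
  next
    case (Suc k)
    show ?case
    proof (cases "x \<in> \<Gamma>")
      case True
      then obtain m y where m: "m \<in> {1..M}" "y \<in> \<Gamma>" "x = s m y" using \<Gamma>_eq by blast
      have "measure \<mu> {x} = p m * measure \<mu> (s m -` {x})"
        using m by (intro measure_in_image) auto
      also have "s m -` {x} = {y}" using inj_map[OF m(1)] m(3) by (auto dest: injD)
      also have "p m * measure \<mu> {y} \<le> q * (q ^ k * measure \<mu> UNIV)"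
        using q_ge[OF m(1)] q Suc.IH[of y] by (intro mult_mono) auto
      finally show ?thesis by simp
    qed (use q null_outside[of "{x}"] in auto)
  qed
  have "(\<lambda>k. q ^ k * measure \<mu> UNIV) \<longlonglongrightarrow> 0"
    using LIMSEQ_realpow_zero[of q] q by (auto intro!: tendsto_mult_left_zero)
  then have "measure \<mu> {x} \<le> 0"
    by (rule LIMSEQ_le_const) (use bound in auto)
  then show ?thesis by (simp add: measure_le_0_iff)
qed

lemma AE_neq: "AE y in \<mu>. y \<noteq> x"
  by (rule AE_I[of _ _ "{x}"]) (auto simp: emeasure_eq_measure singleton_null)

lemma sum_measure_images: "(\<Sum>m=1..M. measure \<mu> (s m ` \<Gamma>)) = measure \<mu> \<Gamma>"
proof -
  have "measure \<mu> (\<Union>m\<in>{1..M}. s m ` \<Gamma>) = (\<Sum>m=1..M. measure \<mu> (s m ` \<Gamma>))"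
    using disjoint_images image_\<Gamma>_borel
    by (intro finite_measure_finite_Union) (auto simp: disjoint_family_on_def sets_eq_borel)
  then show ?thesis using \<Gamma>_eq by simp
qed

lemma sum_measure_pieces:
  assumes "0 < h" "set w \<subseteq> {1..M}"
  shows "(\<Sum>v\<in>L_index M s \<Gamma> h w. measure \<mu> (piece s \<Gamma> (w @ v))) = measure \<mu> (piece s \<Gamma> w)"
proof -
  have "measure \<mu> (\<Union>v\<in>L_index M s \<Gamma> h w. piece s \<Gamma> (w @ v))
          = (\<Sum>v\<in>L_index M s \<Gamma> h w. measure \<mu> (piece s \<Gamma> (w @ v)))"
  proof (rule finite_measure_finite_Union[OF finite_L_index[OF assms]])
    show "disjoint_family_on (\<lambda>v. piece s \<Gamma> (w @ v)) (L_index M s \<Gamma> h w)"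
      using L_index_disjoint assms(2) by (auto simp: disjoint_family_on_def)
    show "(\<lambda>v. piece s \<Gamma> (w @ v)) ` L_index M s \<Gamma> h w \<subseteq> sets \<mu>"
    proof (rule image_subsetI)
      fix v assume "v \<in> L_index M s \<Gamma> h w"
      then have "set (w @ v) \<subseteq> {1..M}" using L_index_word assms(2) by force
      then show "piece s \<Gamma> (w @ v) \<in> sets \<mu>" by (simp only: sets_eq_borel piece_borel)
    qed
  qed
  then show ?thesis by (simp only: UN_pieces[OF assms])
qed

end

section \<open>Finiteness of the energy\<close>

context disjoint_ifs begin

text \<open>
  On the diagonal this is false for \<open>t = 0\<close>, where both kernel values are \<open>ln 0 = 0\<close>.
\<close>

lemma kernel_map:
  assumes "m \<in> {1..M}" "x \<noteq> y"
  shows "\<Phi> t (s m x) (s m y)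
           = (if t = 0 then ln (\<rho> m) else 0) + \<rho> m powr (- t) * \<Phi> t x y"
  using assms ratio(1)[of m] by (simp add: \<Phi>_def norm_map_diff ln_mult powr_mult)

lemma abs_kernel_map:
  assumes "m \<in> {1..M}"
  shows "\<bar>\<Phi> t (s m x) (s m y)\<bar> \<le> \<bar>ln (\<rho> m)\<bar> + \<rho> m powr (- t) * \<bar>\<Phi> t x y\<bar>"
proof (cases "x = y")
  case True
  then show ?thesis by (simp add: \<Phi>_def)
next
  case False
  have "\<bar>\<Phi> t (s m x) (s m y)\<bar>
      \<le> \<bar>if t = 0 then ln (\<rho> m) else 0\<bar> + \<bar>\<rho> m powr (- t) * \<Phi> t x y\<bar>"
    unfolding kernel_map[OF assms False] by (rule abs_triangle_ineq)
  then show ?thesis by (auto simp: abs_mult split: if_splits)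
qed

end

locale ifs_measure_pair =
  disjoint_ifs M \<rho> A \<delta> s \<Gamma> +
  X: invariant_ifs_measure M \<rho> A \<delta> s \<Gamma> p \<mu> +
  Y: invariant_ifs_measure M \<rho> A \<delta> s \<Gamma> p' \<mu>'
  for M \<rho> and A :: "nat \<Rightarrow> real ^ 'n ^ 'n" and \<delta> s \<Gamma> p \<mu> p' \<mu>'
begin

abbreviation \<nu> :: "((real ^ 'n) \<times> (real ^ 'n)) measure" where
  "\<nu> \<equiv> \<mu> \<Otimes>\<^sub>M \<mu>'"

sublocale P: pair_sigma_finite \<mu> \<mu>' ..

sublocale N: finite_measure \<nu>
  by (rule finite_measure_pair_measure[OF Y.finite_measure_axioms X.finite_measure_axioms])

lemma sets_\<nu>: "sets \<nu> = sets borel"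
  using sets_pair_measure_cong[OF X.sets_eq_borel Y.sets_eq_borel] unfolding borel_prod .

lemma measurable_\<nu>: "f \<in> borel_measurable borel \<Longrightarrow> f \<in> borel_measurable \<nu>"
  using measurable_cong_sets[OF sets_\<nu> refl] by blast

lemma Times_in_\<nu>: "B \<in> sets borel \<Longrightarrow> B' \<in> sets borel \<Longrightarrow> B \<times> B' \<in> sets \<nu>"
  by (intro pair_measureI) (simp_all add: X.sets_eq_borel Y.sets_eq_borel)

lemma measure_Times:
  assumes "B \<in> sets borel" "B' \<in> sets borel"
  shows "measure \<nu> (B \<times> B') = measure \<mu> B * measure \<mu>' B'"
  using assms unfolding measure_def
  by (simp add: Y.emeasure_pair_measure_Times X.sets_eq_borel Y.sets_eq_borel enn2real_mult)

lemma map_pair_borel: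
  assumes "m \<in> {1..M}" "f \<in> borel_measurable borel"
  shows "(\<lambda>z. f (s m (fst z), s m (snd z))) \<in> borel_measurable borel"
proof -
  have "continuous_on UNIV (\<lambda>z. (s m (fst z), s m (snd z)))"
    by (intro continuous_on_Pair continuous_on_compose2[OF continuous_map[OF assms(1), of UNIV]]
        continuous_on_fst continuous_on_snd continuous_on_id) auto
  then have "(\<lambda>z. (s m (fst z), s m (snd z))) \<in> borel_measurable borel"
    by (rule borel_measurable_continuous_onI)
  from measurable_compose[OF this assms(2)] show ?thesis .
qed

lemma block_decomposition:
  fixes f :: "(real ^ 'n) \<times> (real ^ 'n) \<Rightarrow> real"
  assumes "set_integrable \<nu> (\<Gamma> \<times> \<Gamma>) f"
  shows "(LINT z:\<Gamma> \<times> \<Gamma>|\<nu>. f z)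
           = (\<Sum>m=1..M. \<Sum>m'=1..M. LINT z:s m ` \<Gamma> \<times> s m' ` \<Gamma>|\<nu>. f z)"
proof -
  have d: "disjoint_family_on (\<lambda>m. s m ` \<Gamma>) {1..M}"
    using disjoint_images by (auto simp: disjoint_family_on_def)
  show ?thesis
    using set_integral_UNION_Times[OF _ _ d d, of \<mu> \<mu>' f] assms image_\<Gamma>_borel
    by (simp only: \<Gamma>_eq[symmetric] X.sets_eq_borel Y.sets_eq_borel finite_atLeastAtMost)
qed

lemma diagonal_block:
  fixes f :: "(real ^ 'n) \<times> (real ^ 'n) \<Rightarrow> real"
  assumes m: "m \<in> {1..M}" and f: "f \<in> borel_measurable borel"
    and int: "set_integrable \<nu> (\<Gamma> \<times> \<Gamma>) f"
  shows "(LINT z:s m ` \<Gamma> \<times> s m ` \<Gamma>|\<nu>. f z)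
           = p m * p' m * (LINT x:\<Gamma>|\<mu>. LINT y:\<Gamma>|\<mu>'. f (s m x, s m y))"
proof -
  have f': "f \<in> borel_measurable (borel \<Otimes>\<^sub>M borel)" using f by (simp add: borel_prod)
  have sub: "s m ` \<Gamma> \<times> s m ` \<Gamma> \<subseteq> \<Gamma> \<times> \<Gamma>" using map_in_\<Gamma>[OF m] by auto
  have "(LINT z:s m ` \<Gamma> \<times> s m ` \<Gamma>|\<nu>. f z)
      = (LINT x:s m ` \<Gamma>|\<mu>. LINT y:s m ` \<Gamma>|\<mu>'. f (x, y))"
    using image_\<Gamma>_borel[OF m]
    by (intro P.set_integral_Times set_integrable_subset[OF int _ sub] Times_in_\<nu>)
  also have "\<dots> = p m * (LINT x:\<Gamma>|\<mu>. LINT y:s m ` \<Gamma>|\<mu>'. f (s m x, y))"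
  proof (rule X.image_integral[OF m])
    have [measurable]: "s m ` \<Gamma> \<in> sets borel" "f \<in> borel_measurable (borel \<Otimes>\<^sub>M borel)"
      using image_\<Gamma>_borel[OF m] f' by auto
    show "(\<lambda>x. LINT y:s m ` \<Gamma>|\<mu>'. f (x, y)) \<in> borel_measurable borel"
      unfolding set_lebesgue_integral_def by measurable
  qed
  also have "(\<lambda>x. LINT y:s m ` \<Gamma>|\<mu>'. f (s m x, y))
      = (\<lambda>x. p' m * (LINT y:\<Gamma>|\<mu>'. f (s m x, s m y)))"
  proof
    fix x
    have "(\<lambda>y. f (s m x, y)) \<in> borel_measurable borel"
      using f' by measurable
    then show "(LINT y:s m ` \<Gamma>|\<mu>'. f (s m x, y)) = p' m * (LINT y:\<Gamma>|\<mu>'. f (s m x, s m y))"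
      by (rule Y.image_integral[OF m])
  qed
  finally show ?thesis by simp
qed

text \<open>
  Let \<open>E k\<close> be the integral of \<open>min k g\<close> over \<open>\<Gamma> \<times> \<Gamma>\<close>, which is finite.  Truncation respects the
  scaling inequality, as \<open>a m \<ge> 0\<close> and \<open>b m \<ge> 1\<close>; so the block decomposition gives
  \<open>E k \<le> S + c * E k\<close> with \<open>c < 1\<close> and with \<open>S\<close> independent of \<open>k\<close>.  Hence \<open>E\<close> is bounded, and monotone
  convergence applies.
\<close>

lemma self_similar_integrable:
  fixes g :: "(real ^ 'n) \<times> (real ^ 'n) \<Rightarrow> real"
  assumes meas: "g \<in> borel_measurable borel" and nonneg: "\<And>z. 0 \<le> g z"
    and a: "\<And>m. m \<in> {1..M} \<Longrightarrow> 0 \<le> a m" and b: "\<And>m. m \<in> {1..M} \<Longrightarrow> 1 \<le> b m"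
    and scaling: "\<And>m x y. m \<in> {1..M} \<Longrightarrow> g (s m x, s m y) \<le> a m + b m * g (x, y)"
    and contract: "(\<Sum>m=1..M. p m * p' m * b m) < 1"
    and off_diagonal: "\<And>m m'. m \<in> {1..M} \<Longrightarrow> m' \<in> {1..M} \<Longrightarrow> m \<noteq> m' \<Longrightarrow>
      set_integrable \<nu> (s m ` \<Gamma> \<times> s m' ` \<Gamma>) g"
  shows "set_integrable \<nu> (\<Gamma> \<times> \<Gamma>) g"
proof -
  define G where "G = (\<lambda>(k::nat) z. min (real k) (g z))"
  define E where "E = (\<lambda>k. LINT z:\<Gamma> \<times> \<Gamma>|\<nu>. G k z)"
  define V where "V = measure \<mu> \<Gamma> * measure \<mu>' \<Gamma>"
  define c where "c = (\<Sum>m=1..M. p m * p' m * b m)"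
  define T where "T = (\<lambda>m m'. if m = m' then p m * p' m * (a m * V)
    else (LINT z:s m ` \<Gamma> \<times> s m' ` \<Gamma>|\<nu>. g z))"
  define S where "S = (\<Sum>m=1..M. \<Sum>m'=1..M. T m m')"
  have G_meas: "G k \<in> borel_measurable borel" for k
    unfolding G_def using meas by measurable
  have G_bound: "norm (G k z) \<le> real k" for k z
    using nonneg[of z] by (simp add: G_def)
  have G_int: "set_integrable \<nu> B (G k)" if "B \<in> sets \<nu>" for B k
    by (rule N.set_integrable_of_bounded[OF that measurable_\<nu>[OF G_meas] G_bound])
  have \<Gamma>\<Gamma>: "\<Gamma> \<times> \<Gamma> \<in> sets \<nu>" by (intro Times_in_\<nu> \<Gamma>_borel)
  have const_int: "set_integrable \<nu> (\<Gamma> \<times> \<Gamma>) (\<lambda>_. r)" for r :: real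
    by (rule N.set_integrable_of_bounded[of _ _ "\<bar>r\<bar>"]) (use \<Gamma>\<Gamma> in auto)
  \<comment> \<open>On the diagonal the truncated function obeys the scaling inequality; off the diagonal it is
    dominated by \<open>g\<close>.\<close>
  have block: "(LINT z:s m ` \<Gamma> \<times> s m' ` \<Gamma>|\<nu>. G k z)
      \<le> T m m' + (if m = m' then p m * p' m * b m * E k else 0)"
    if m: "m \<in> {1..M}" and m': "m' \<in> {1..M}" for m m' k
  proof (cases "m = m'")
    case False
    have "(LINT z:s m ` \<Gamma> \<times> s m' ` \<Gamma>|\<nu>. G k z) \<le> (LINT z:s m ` \<Gamma> \<times> s m' ` \<Gamma>|\<nu>. g z)"
      using m m' False
      by (intro set_integral_mono G_int Times_in_\<nu> image_\<Gamma>_borel off_diagonal) (auto simp: G_def)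
    then show ?thesis using False by (simp add: T_def)
  next
    case True
    let ?H = "\<lambda>z. G k (s m (fst z), s m (snd z))"
    have H_int: "set_integrable \<nu> (\<Gamma> \<times> \<Gamma>) ?H"
      by (rule N.set_integrable_of_bounded[of _ _ "real k"])
        (use \<Gamma>\<Gamma> G_bound in \<open>auto intro: measurable_\<nu> map_pair_borel[OF m G_meas]\<close>)
    have "(LINT x:\<Gamma>|\<mu>. LINT y:\<Gamma>|\<mu>'. G k (s m x, s m y)) = (LINT z:\<Gamma> \<times> \<Gamma>|\<nu>. ?H z)"
      using P.set_integral_Times[OF H_int] by simp
    also have "\<dots> \<le> (LINT z:\<Gamma> \<times> \<Gamma>|\<nu>. a m + b m * G k z)"
    proof (intro set_integral_mono H_int set_integral_add const_int set_integrable_mult_right G_int \<Gamma>\<Gamma>)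
      fix z
      have "real k \<le> b m * real k" using b[OF m] by (simp add: mult_le_cancel_right1)
      then have "real k \<le> a m + b m * real k" using a[OF m] by linarith
      moreover have "g (s m (fst z), s m (snd z)) \<le> a m + b m * g z"
        using scaling[OF m, of "fst z" "snd z"] by simp
      ultimately show "?H z \<le> a m + b m * G k z"
        by (cases "real k \<le> g z") (auto simp: G_def min_def)
    qed
    also have "\<dots> = (LINT z:\<Gamma> \<times> \<Gamma>|\<nu>. a m) + (LINT z:\<Gamma> \<times> \<Gamma>|\<nu>. b m * G k z)"
      by (intro set_integral_add const_int set_integrable_mult_right G_int \<Gamma>\<Gamma>)
    also have "\<dots> = a m * V + b m * E k"
      by (simp add: E_def N.set_integral_const[OF \<Gamma>\<Gamma>] measure_Times V_def)
    finally have "p m * p' m * (LINT x:\<Gamma>|\<mu>. LINT y:\<Gamma>|\<mu>'. G k (s m x, s m y))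
        \<le> p m * p' m * (a m * V + b m * E k)"
      using X.weight(1)[OF m] Y.weight(1)[OF m] by (intro mult_left_mono) auto
    then show ?thesis
      using True diagonal_block[OF m G_meas G_int[OF \<Gamma>\<Gamma>]] by (simp add: T_def algebra_simps)
  qed
  have E_le: "E k \<le> S / (1 - c)" for k
  proof -
    have "E k = (\<Sum>m=1..M. \<Sum>m'=1..M. LINT z:s m ` \<Gamma> \<times> s m' ` \<Gamma>|\<nu>. G k z)"
      unfolding E_def by (rule block_decomposition[OF G_int[OF \<Gamma>\<Gamma>]])
    also have "\<dots> \<le> (\<Sum>m=1..M. \<Sum>m'=1..M.
        T m m' + (if m = m' then p m * p' m * b m * E k else 0))"
      by (intro sum_mono block)
    also have "\<dots> = S + c * E k"
      by (simp add: S_def c_def sum.distrib sum_distrib_right)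
    finally have "E k \<le> S + c * E k" .
    moreover have "c < 1" using contract by (simp add: c_def)
    ultimately show ?thesis by (simp add: pos_le_divide_eq algebra_simps)
  qed
  have G_mono: "k \<le> l \<Longrightarrow> G k z \<le> G l z" for k l z
    by (auto simp: G_def)
  have "incseq E"
    unfolding E_def by (intro incseq_SucI set_integral_mono G_int \<Gamma>\<Gamma> G_mono) auto
  then obtain L where L: "E \<longlonglongrightarrow> L"
    using incseq_convergent[of E "S / (1 - c)"] E_le by blast
  show ?thesis
    unfolding set_integrable_def
  proof (rule integrable_monotone_convergence)
    show "integrable \<nu> (\<lambda>z. indicator (\<Gamma> \<times> \<Gamma>) z *\<^sub>R G k z)" for k
      using G_int[OF \<Gamma>\<Gamma>] by (simp add: set_integrable_def)
    show "AE z in \<nu>. mono (\<lambda>k. indicator (\<Gamma> \<times> \<Gamma>) z *\<^sub>R G k z)"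
      by (intro AE_I2 monoI scaleR_left_mono G_mono) auto
    show "AE z in \<nu>. (\<lambda>k. indicator (\<Gamma> \<times> \<Gamma>) z *\<^sub>R G k z) \<longlonglongrightarrow> indicator (\<Gamma> \<times> \<Gamma>) z *\<^sub>R g z"
    proof (intro AE_I2 tendsto_intros)
      fix z
      have "\<forall>\<^sub>F k in sequentially. g z \<le> real k"
        by (meson eventually_sequentiallyI le_nat_iff nat_ceiling_le_eq)
      then have "\<forall>\<^sub>F k in sequentially. G k z = g z"
        by eventually_elim (simp add: G_def)
      then show "(\<lambda>k. G k z) \<longlonglongrightarrow> g z" by (rule tendsto_eventually)
    qed
    show "(\<lambda>k. LINT z|\<nu>. indicator (\<Gamma> \<times> \<Gamma>) z *\<^sub>R G k z) \<longlonglongrightarrow> L"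
      using L by (simp add: E_def set_lebesgue_integral_def)
    show "(\<lambda>z. indicator (\<Gamma> \<times> \<Gamma>) z *\<^sub>R g z) \<in> borel_measurable \<nu>"
      using \<Gamma>\<Gamma> measurable_\<nu>[OF meas] by measurable
  qed
qed

lemma off_diagonal_integrable:
  fixes f :: "(real ^ 'n) \<times> (real ^ 'n) \<Rightarrow> real"
  assumes m: "m \<in> {1..M}" "m' \<in> {1..M}" "m \<noteq> m'"
    and f: "f \<in> borel_measurable borel" "continuous_on {z. fst z \<noteq> snd z} f"
  shows "set_integrable \<nu> (s m ` \<Gamma> \<times> s m' ` \<Gamma>) f"
proof -
  let ?B = "s m ` \<Gamma> \<times> s m' ` \<Gamma>"
  have "compact ?B"
    using m by (intro compact_Times compact_continuous_image continuous_map compact_\<Gamma>)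
  moreover have "?B \<subseteq> {z. fst z \<noteq> snd z}" using disjoint_images[OF m] by auto
  ultimately have "bounded (f ` ?B)"
    by (intro compact_imp_bounded compact_continuous_image continuous_on_subset[OF f(2)])
  then obtain K where "\<And>z. z \<in> ?B \<Longrightarrow> norm (f z) \<le> K"
    unfolding bounded_iff by (metis imageI)
  then show ?thesis
    using m by (intro N.set_integrable_of_bounded[of _ _ K] Times_in_\<nu> image_\<Gamma>_borel measurable_\<nu> f)
qed

end

section \<open>Separation of the convex hulls\<close>

context disjoint_ifs begin

lemma finite_hull_distances:
  assumes "0 < h"
  shows "finite {setdist (convex hull (piece s \<Gamma> w)) (convex hull (piece s \<Gamma> w')) | w w'.
            w \<in> L_index M s \<Gamma> h [] \<and> w' \<in> L_index M s \<Gamma> h [] \<and> hd w \<noteq> hd w'}"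
  by (rule finite_subset[of _ "(\<lambda>(w, w'). setdist (convex hull (piece s \<Gamma> w)) (convex hull (piece s \<Gamma> w')))
      ` (L_index M s \<Gamma> h [] \<times> L_index M s \<Gamma> h [])"])
    (use finite_L_index[OF assms, of "[]"] in auto)

lemma hull_distances_nonempty:
  assumes "0 < h" "h < diameter \<Gamma>"
  shows "{setdist (convex hull (piece s \<Gamma> w)) (convex hull (piece s \<Gamma> w')) | w w'.
            w \<in> L_index M s \<Gamma> h [] \<and> w' \<in> L_index M s \<Gamma> h [] \<and> hd w \<noteq> hd w'} \<noteq> {}"
proof -
  have "\<exists>w\<in>L_index M s \<Gamma> h []. hd w = m" if m: "m \<in> {1..M}" for m
  proof -
    obtain x where "x \<in> piece s \<Gamma> [m]" using piece_nonempty by blast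
    then obtain v where "v \<in> L_index M s \<Gamma> h [m]" using pieces_cover[OF assms(1), of "[m]"] m by auto
    then show ?thesis using L_index_Cons[OF m assms(2)] by force
  qed
  from this[of 1] this[of 2] obtain w w'
    where "w \<in> L_index M s \<Gamma> h []" "w' \<in> L_index M s \<Gamma> h []" "hd w = 1" "hd w' = 2"
    using M_ge_2 by auto
  then have "hd w \<noteq> hd w'" by simp
  then show ?thesis using \<open>w \<in> _\<close> \<open>w' \<in> _\<close> by blast
qed

lemma R_Hull_h_le:
  assumes "0 < h" "w \<in> L_index M s \<Gamma> h []" "w' \<in> L_index M s \<Gamma> h []" "hd w \<noteq> hd w'"
  shows "R_Hull_h M s \<Gamma> h \<le> setdist (convex hull (piece s \<Gamma> w)) (convex hull (piece s \<Gamma> w'))"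
  unfolding R_Hull_h_def using assms by (intro Min_le finite_hull_distances) auto

lemma R_Hull_h_pos:
  assumes h: "0 < h" "h < diameter \<Gamma>"
    and disj: "\<And>w w'. w \<in> L_index M s \<Gamma> h [] \<Longrightarrow> w' \<in> L_index M s \<Gamma> h [] \<Longrightarrow> hd w \<noteq> hd w' \<Longrightarrow>
      convex hull (piece s \<Gamma> w) \<inter> convex hull (piece s \<Gamma> w') = {}"
  shows "0 < R_Hull_h M s \<Gamma> h"
proof -
  have "0 < setdist (convex hull (piece s \<Gamma> w)) (convex hull (piece s \<Gamma> w'))"
    if w: "w \<in> L_index M s \<Gamma> h []" "w' \<in> L_index M s \<Gamma> h []" "hd w \<noteq> hd w'" for w w'
  proof -
    have c: "compact (convex hull (piece s \<Gamma> w))" "compact (convex hull (piece s \<Gamma> w'))"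
      using L_index_word[OF w(1)] L_index_word[OF w(2)]
      by (simp_all only: compact_convex_hull compact_piece)
    have "setdist (convex hull (piece s \<Gamma> w)) (convex hull (piece s \<Gamma> w')) \<noteq> 0"
      using disj[OF w] piece_nonempty
      by (simp add: setdist_eq_0_compact_closed[OF c(1) compact_imp_closed[OF c(2)]])
    then show ?thesis using setdist_pos_le by (metis order_le_less)
  qed
  then show ?thesis
    unfolding R_Hull_h_def
    using finite_hull_distances[OF h(1)] hull_distances_nonempty[OF h]
    by (subst Min_gr_iff) auto
qed

lemma R_Hull_le_R_Hull_h:
  assumes h: "0 < h" "h < diameter \<Gamma>"
  shows "R_Hull M s \<Gamma> \<le> R_Hull_h M s \<Gamma> h"
  unfolding R_Hull_h_def
proof (rule Min.boundedI[OF finite_hull_distances[OF h(1)] hull_distances_nonempty[OF h]], clarify)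
  fix w w' assume w: "w \<in> L_index M s \<Gamma> h []" "w' \<in> L_index M s \<Gamma> h []" "hd w \<noteq> hd w'"
  have hd_word: "hd w \<in> {1..M} \<and> convex hull (piece s \<Gamma> w) \<subseteq> s (hd w) ` (convex hull \<Gamma>)"
    if "w \<in> L_index M s \<Gamma> h []" for w
  proof -
    have ne: "w \<noteq> []" using that h(2) by (simp add: L_index_def)
    then have m: "hd w \<in> {1..M}" "set (tl w) \<subseteq> {1..M}"
      using L_index_word[OF that] by (auto simp: neq_Nil_conv)
    have "piece s \<Gamma> w \<subseteq> s (hd w) ` \<Gamma>"
      using piece_append_subset[OF m(2), of "[hd w]"] ne by (simp add: piece_Cons)
    then show ?thesis using m hull_mono by (metis map_convex_hull)
  qed
  have "R_Hull M s \<Gamma> \<le> setdist (s (hd w) ` (convex hull \<Gamma>)) (s (hd w') ` (convex hull \<Gamma>))"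
    unfolding R_Hull_def using hd_word w by (intro Min_le finite_pairs) blast
  also have "\<dots> \<le> setdist (convex hull (piece s \<Gamma> w)) (s (hd w') ` (convex hull \<Gamma>))"
    using hd_word[OF w(1)] piece_nonempty by (intro setdist_subset_left) auto
  also have "\<dots> \<le> setdist (convex hull (piece s \<Gamma> w)) (convex hull (piece s \<Gamma> w'))"
    using hd_word[OF w(2)] piece_nonempty by (intro setdist_subset_right) auto
  finally show "R_Hull M s \<Gamma> \<le> setdist (convex hull (piece s \<Gamma> w)) (convex hull (piece s \<Gamma> w'))" .
qed

end

section \<open>The energy integral and its quadrature\<close>

lemma (in invariant_ifs_measure) measure_\<Gamma>_pos: "0 < measure \<mu> \<Gamma>"
proof -
  have "measure \<mu> UNIV = measure \<mu> \<Gamma> + measure \<mu> (- \<Gamma>)"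
    by (subst finite_measure_Union[symmetric]) (auto simp: sets_eq_borel)
  then show ?thesis
    using invariant measure_nonneg[of \<mu> \<Gamma>] by (auto simp: invariant_measure_def less_le)
qed

lemma (in invariant_ifs_measure) measure_piece_pos:
  "set w \<subseteq> {1..M} \<Longrightarrow> 0 < measure \<mu> (piece s \<Gamma> w)"
proof (induction w)
  case (Cons m w)
  then have m: "m \<in> {1..M}" and w: "set w \<subseteq> {1..M}" by auto
  have "measure \<mu> (piece s \<Gamma> (m # w)) = p m * measure \<mu> (s m -` piece s \<Gamma> (m # w))"
    using piece_borel[OF Cons.prems] piece_subset_\<Gamma>[OF w]
    by (intro measure_in_image m) (auto simp: piece_Cons)
  also have "s m -` piece s \<Gamma> (m # w) = piece s \<Gamma> w"
    using inj_map[OF m] by (simp add: piece_Cons inj_vimage_image_eq)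
  finally show ?case using Cons.IH[OF w] weight(1)[OF m] by simp
qed (simp add: measure_\<Gamma>_pos)

context ifs_measure_pair begin

text \<open>
  The words of \<open>L_index\<close> relative to \<open>\<Gamma>\<^sub>m\<close> split the block into products of small pieces.  With
  the letter \<open>m\<close> prepended they are words of \<open>L_index\<close> for \<open>\<Gamma>\<close>, so that \<open>R_Hull_h\<close> bounds the
  distances of the convex hulls from below.
\<close>

lemma off_diagonal_error:
  assumes m: "m \<in> {1..M}" "m' \<in> {1..M}" "m \<noteq> m'" and t: "0 \<le> t"
    and h: "0 < h" "h < diameter \<Gamma>" and R: "0 < R_Hull_h M s \<Gamma> h"
  shows "\<bar>(LINT z:s m ` \<Gamma> \<times> s m' ` \<Gamma>|\<nu>. \<Phi> t (fst z) (snd z)) - barycentre_rule M s \<Gamma> \<mu> \<mu>' h m m' (\<Phi> t)\<bar>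
           \<le> 2 * a_const t * h\<^sup>2 / R_Hull_h M s \<Gamma> h powr (t + 2)
               * measure \<mu> (s m ` \<Gamma>) * measure \<mu>' (s m' ` \<Gamma>)"
proof -
  define C where "C = 2 * a_const t * h\<^sup>2 / R_Hull_h M s \<Gamma> h powr (t + 2)"
  let ?I = "L_index M s \<Gamma> h [m]" and ?I' = "L_index M s \<Gamma> h [m']"
  let ?B = "\<lambda>v. piece s \<Gamma> (m # v)" and ?B' = "\<lambda>v. piece s \<Gamma> (m' # v)"
  let ?q = "\<lambda>v v'. measure \<mu> (?B v) * measure \<mu>' (?B' v')
      * \<Phi> t (barycentre \<mu> (?B v)) (barycentre \<mu>' (?B' v'))"
  have fin: "finite ?I" "finite ?I'" using m h by (auto intro: finite_L_index)
  have word: "set (m # v) \<subseteq> {1..M}" if "v \<in> ?I" for v using L_index_word[OF that] m by simp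
  have word': "set (m' # v) \<subseteq> {1..M}" if "v \<in> ?I'" for v using L_index_word[OF that] m by simp
  have U: "s m ` \<Gamma> = (\<Union>v\<in>?I. ?B v)" using UN_pieces[OF h(1), of "[m]"] m by (simp add: piece_Cons)
  have U': "s m' ` \<Gamma> = (\<Union>v\<in>?I'. ?B' v)" using UN_pieces[OF h(1), of "[m']"] m by (simp add: piece_Cons)
  have d: "disjoint_family_on ?B ?I"
    using L_index_disjoint[of _ h "[m]"] m by (auto simp: disjoint_family_on_def)
  have d': "disjoint_family_on ?B' ?I'"
    using L_index_disjoint[of _ h "[m']"] m by (auto simp: disjoint_family_on_def)
  have "(LINT z:s m ` \<Gamma> \<times> s m' ` \<Gamma>|\<nu>. \<Phi> t (fst z) (snd z))
      = (\<Sum>v\<in>?I. \<Sum>v'\<in>?I'. LINT z:?B v \<times> ?B' v'|\<nu>. \<Phi> t (fst z) (snd z))"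
    unfolding U U'
  proof (rule set_integral_UNION_Times[OF fin d d'])
    show "?B v \<in> sets \<mu>" if "v \<in> ?I" for v
      unfolding X.sets_eq_borel by (rule piece_borel[OF word[OF that]])
    show "?B' v \<in> sets \<mu>'" if "v \<in> ?I'" for v
      unfolding Y.sets_eq_borel by (rule piece_borel[OF word'[OF that]])
    show "set_integrable \<nu> ((\<Union>v\<in>?I. ?B v) \<times> (\<Union>v\<in>?I'. ?B' v)) (\<lambda>z. \<Phi> t (fst z) (snd z))"
      unfolding U[symmetric] U'[symmetric]
      by (rule off_diagonal_integrable[OF m kernel_borel kernel_continuous])
  qed
  moreover have "barycentre_rule M s \<Gamma> \<mu> \<mu>' h m m' (\<Phi> t) = (\<Sum>v\<in>?I. \<Sum>v'\<in>?I'. ?q v v')"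
    by (simp add: barycentre_rule_def)
  ultimately have "\<bar>(LINT z:s m ` \<Gamma> \<times> s m' ` \<Gamma>|\<nu>. \<Phi> t (fst z) (snd z))
        - barycentre_rule M s \<Gamma> \<mu> \<mu>' h m m' (\<Phi> t)\<bar>
      = \<bar>\<Sum>v\<in>?I. \<Sum>v'\<in>?I'. (LINT z:?B v \<times> ?B' v'|\<nu>. \<Phi> t (fst z) (snd z)) - ?q v v'\<bar>"
    by (simp add: sum_subtractf)
  also have "\<dots> \<le> (\<Sum>v\<in>?I. \<Sum>v'\<in>?I'. \<bar>(LINT z:?B v \<times> ?B' v'|\<nu>. \<Phi> t (fst z) (snd z)) - ?q v v'\<bar>)"
    by (intro order_trans[OF sum_abs] sum_mono sum_abs)
  also have "\<dots> \<le> (\<Sum>v\<in>?I. \<Sum>v'\<in>?I'. C * measure \<mu> (?B v) * measure \<mu>' (?B' v'))"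
  proof (intro sum_mono)
    fix v v' assume v: "v \<in> ?I" "v' \<in> ?I'"
    have "R_Hull_h M s \<Gamma> h \<le> setdist (convex hull ?B v) (convex hull ?B' v')"
      using v m L_index_Cons[OF _ h(2)] by (intro R_Hull_h_le h) auto
    then show "\<bar>(LINT z:?B v \<times> ?B' v'|\<nu>. \<Phi> t (fst z) (snd z)) - ?q v v'\<bar>
        \<le> C * measure \<mu> (?B v) * measure \<mu>' (?B' v')"
      unfolding C_def using L_index_diameter[OF v(1)] L_index_diameter[OF v(2)]
      by (intro kernel_barycentre_error X.finite_measure_axioms Y.finite_measure_axioms
          X.sets_eq_borel Y.sets_eq_borel compact_piece word[OF v(1)] word'[OF v(2)]
          X.measure_piece_pos Y.measure_piece_pos t R) auto
  qed
  also have "\<dots> = C * (\<Sum>v\<in>?I. measure \<mu> (?B v)) * (\<Sum>v'\<in>?I'. measure \<mu>' (?B' v'))"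
    by (simp add: sum_distrib_left sum_distrib_right mult_ac)
  also have "\<dots> = C * measure \<mu> (s m ` \<Gamma>) * measure \<mu>' (s m' ` \<Gamma>)"
    using X.sum_measure_pieces[OF h(1), of "[m]"] Y.sum_measure_pieces[OF h(1), of "[m']"] m
    by (simp add: piece_Cons)
  finally show ?thesis by (simp only: C_def)
qed

lemma sum_weights_less_1: "(\<Sum>m=1..M. p m * p' m) < 1"
proof -
  have "(\<Sum>m=1..M. p m * p' m) < (\<Sum>m=1..M. p m)"
  proof (rule sum_strict_mono)
    show "{1..M} \<noteq> {}" using M_ge_2 by auto
    show "p m * p' m < p m" if "m \<in> {1..M}" for m
      using X.weight(1)[OF that] Y.weight(2)[OF that] by simp
  qed simp
  then show ?thesis unfolding X.weight(3) .
qed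

text \<open>
  The sum is strictly increasing and continuous in the exponent, less than 1 at 0, and at least 1
  at the exponent \<open>T\<close> for which the first summand alone equals 1.  So it takes the value 1 exactly
  once, and this is where \<open>t_star\<close> lies.
\<close>

lemma sum_less_1_of_less_t_star:
  assumes t: "0 \<le> t" "t < t_star M \<rho> p p'"
  shows "(\<Sum>m=1..M. p m * p' m * \<rho> m powr (- t)) < 1"
proof -
  define F where "F = (\<lambda>t. \<Sum>m=1..M. p m * p' m * \<rho> m powr (- t))"
  have mono: "F u < F v" if "u < v" for u v
    unfolding F_def
  proof (rule sum_strict_mono)
    show "{1..M} \<noteq> {}" using M_ge_2 by auto
    fix m assume m: "m \<in> {1..M}"
    have "\<rho> m powr (- u) < \<rho> m powr (- v)"
      using ratio[OF m] that by (simp add: powr_def)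
    then show "p m * p' m * \<rho> m powr (- u) < p m * p' m * \<rho> m powr (- v)"
      using X.weight(1)[OF m] Y.weight(1)[OF m] by simp
  qed simp
  have F0: "F 0 < 1"
  proof -
    have "F 0 = (\<Sum>m=1..M. p m * p' m)"
      unfolding F_def using ratio(1) by (intro sum.cong) (auto simp: less_le)
    then show ?thesis using sum_weights_less_1 by simp
  qed
  have one: "1 \<in> {1..M}" using M_ge_2 by simp
  \<comment> \<open>\<open>T\<close> solves \<open>c * \<rho> 1 powr (- T) = 1\<close>.\<close>
  define c where "c = p 1 * p' 1"
  define T where "T = ln c / ln (\<rho> 1)"
  have c: "0 < c" "c < 1"
    using X.weight(1,2)[OF one] Y.weight(1,2)[OF one] mult_strict_mono[of "p 1" 1 "p' 1" 1]
    by (auto simp: c_def)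
  have ln_neg: "ln (\<rho> 1) < 0" using ratio[OF one] by simp
  have "0 \<le> T" using c ln_neg by (simp add: T_def divide_nonpos_neg)
  have "\<rho> 1 powr (- T) = inverse c"
    using ratio(1)[OF one] ln_neg c by (simp add: powr_def T_def exp_minus)
  then have "1 = p 1 * p' 1 * \<rho> 1 powr (- T)" using c unfolding c_def[symmetric] by simp
  also have "\<dots> \<le> F T"
    unfolding F_def using one X.weight(1) Y.weight(1)
    by (intro member_le_sum) (auto simp: less_imp_le)
  finally have FT: "1 \<le> F T" .
  have "continuous_on {0..T} F"
    unfolding F_def using ratio(1) by (intro continuous_intros) force
  then obtain r where r: "0 \<le> r" "r \<le> T" "F r = 1"
    using IVT'[of F 0 1 T] F0 FT \<open>0 \<le> T\<close> by auto
  have "r \<noteq> 0" using r(3) F0 by auto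
  have "t_star M \<rho> p p' = (THE u. 0 < u \<and> F u = 1)"
    by (simp only: t_star_def F_def)
  also have "\<dots> = r"
  proof (rule the_equality)
    show "0 < r \<and> F r = 1" using r \<open>r \<noteq> 0\<close> by simp
    show "u = r" if "0 < u \<and> F u = 1" for u
      using that r(3) mono[of u r] mono[of r u] by (metis less_irrefl linorder_neqE_linordered_idom)
  qed
  finally show ?thesis using mono[of t r] t r(3) by (simp add: F_def)
qed

lemma kernel_integrable:
  assumes t: "0 \<le> t" and contract: "(\<Sum>m=1..M. p m * p' m * \<rho> m powr (- t)) < 1"
  shows "set_integrable \<nu> (\<Gamma> \<times> \<Gamma>) (\<lambda>z. \<Phi> t (fst z) (snd z))"
proof -
  have \<Gamma>\<Gamma>: "\<Gamma> \<times> \<Gamma> \<in> sets \<nu>" by (intro Times_in_\<nu> \<Gamma>_borel)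
  have "set_integrable \<nu> (\<Gamma> \<times> \<Gamma>) (\<lambda>z. \<bar>\<Phi> t (fst z) (snd z)\<bar>)"
  proof (rule self_similar_integrable[where a = "\<lambda>m. \<bar>ln (\<rho> m)\<bar>" and b = "\<lambda>m. \<rho> m powr (- t)"])
    show "(\<lambda>z. \<bar>\<Phi> t (fst z) (snd z)\<bar>) \<in> borel_measurable borel"
      using kernel_borel by measurable
    show "1 \<le> \<rho> m powr (- t)" if "m \<in> {1..M}" for m
    proof -
      have "\<rho> m powr 0 \<le> \<rho> m powr (- t)"
        using ratio[OF that] t by (intro powr_mono') auto
      then show ?thesis using ratio(1)[OF that] by simp
    qed
    show "set_integrable \<nu> (s m ` \<Gamma> \<times> s m' ` \<Gamma>) (\<lambda>z. \<bar>\<Phi> t (fst z) (snd z)\<bar>)"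
      if "m \<in> {1..M}" "m' \<in> {1..M}" "m \<noteq> m'" for m m'
      by (intro set_integrable_abs off_diagonal_integrable[OF that] kernel_borel kernel_continuous)
  qed (use abs_kernel_map contract in auto)
  then show ?thesis
    using set_integrable_abs_iff'[OF measurable_\<nu>[OF kernel_borel] \<Gamma>\<Gamma>] by simp
qed

text \<open>
  The scaling law of the kernel holds off the diagonal, which suffices because points are null.
\<close>

lemma diagonal_energy:
  assumes m: "m \<in> {1..M}" and int: "set_integrable \<nu> (\<Gamma> \<times> \<Gamma>) (\<lambda>z. \<Phi> t (fst z) (snd z))"
  shows "(LINT z:s m ` \<Gamma> \<times> s m ` \<Gamma>|\<nu>. \<Phi> t (fst z) (snd z))
           = p m * p' m * ((if t = 0 then ln (\<rho> m) else 0) * measure \<mu> \<Gamma> * measure \<mu>' \<Gamma>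
               + \<rho> m powr (- t) * (LINT z:\<Gamma> \<times> \<Gamma>|\<nu>. \<Phi> t (fst z) (snd z)))"
proof -
  let ?k = "if t = 0 then ln (\<rho> m) else 0" and ?r = "\<rho> m powr (- t)"
  have \<Gamma>\<Gamma>: "\<Gamma> \<times> \<Gamma> \<in> sets \<nu>" by (intro Times_in_\<nu> \<Gamma>_borel)
  have const_int: "set_integrable \<nu> (\<Gamma> \<times> \<Gamma>) (\<lambda>_. ?k)"
    by (rule N.set_integrable_of_bounded[of _ _ "\<bar>?k\<bar>"]) (use \<Gamma>\<Gamma> in auto)
  have meas: "\<Phi> t x \<in> borel_measurable borel" for x :: "real ^ 'n"
    unfolding \<Phi>_def by measurable
  have "(LINT y:\<Gamma>|\<mu>'. \<Phi> t (s m x) (s m y)) = (LINT y:\<Gamma>|\<mu>'. ?k + ?r * \<Phi> t x y)" for x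
  proof (rule set_lebesgue_integral_cong_AE)
    show "\<Gamma> \<in> sets \<mu>'" by (simp add: Y.sets_eq_borel)
    show "(\<lambda>y. \<Phi> t (s m x) (s m y)) \<in> borel_measurable \<mu>'"
      using measurable_compose[OF map_borel[OF m] meas]
      by (simp add: measurable_cong_sets[OF Y.sets_eq_borel refl])
    show "(\<lambda>y. ?k + ?r * \<Phi> t x y) \<in> borel_measurable \<mu>'"
      using meas[of x] unfolding measurable_cong_sets[OF Y.sets_eq_borel refl] by measurable
    show "AE y\<in>\<Gamma> in \<mu>'. \<Phi> t (s m x) (s m y) = ?k + ?r * \<Phi> t x y"
      using Y.AE_neq[of x] by eventually_elim (simp only: kernel_map[OF m] not_sym simp_thms)
  qed
  then have "(LINT x:\<Gamma>|\<mu>. LINT y:\<Gamma>|\<mu>'. \<Phi> t (s m x) (s m y))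
      = (LINT x:\<Gamma>|\<mu>. LINT y:\<Gamma>|\<mu>'. ?k + ?r * \<Phi> t x y)"
    by simp
  also have "\<dots> = (LINT z:\<Gamma> \<times> \<Gamma>|\<nu>. ?k + ?r * \<Phi> t (fst z) (snd z))"
    by (subst P.set_integral_Times)
      (simp_all only: fst_conv snd_conv set_integral_add(1) const_int set_integrable_mult_right int)
  also have "\<dots> = (LINT z:\<Gamma> \<times> \<Gamma>|\<nu>. ?k) + (LINT z:\<Gamma> \<times> \<Gamma>|\<nu>. ?r * \<Phi> t (fst z) (snd z))"
    by (intro set_integral_add const_int set_integrable_mult_right int)
  also have "\<dots> = ?k * measure \<mu> \<Gamma> * measure \<mu>' \<Gamma> + ?r * (LINT z:\<Gamma> \<times> \<Gamma>|\<nu>. \<Phi> t (fst z) (snd z))"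
    by (simp add: N.set_integral_const[OF \<Gamma>\<Gamma>] measure_Times)
  finally show ?thesis
    using diagonal_block[OF m kernel_borel int] by simp
qed

lemma energy_integral_recursion:
  assumes int: "set_integrable \<nu> (\<Gamma> \<times> \<Gamma>) (\<lambda>z. \<Phi> t (fst z) (snd z))"
  shows "(1 - (\<Sum>m=1..M. p m * p' m * \<rho> m powr (- t))) * energy_integral \<Gamma> \<mu> \<mu>' (\<Phi> t)
    = (\<Sum>m=1..M. p m * p' m * measure \<mu> \<Gamma> * measure \<mu>' \<Gamma> * (if t = 0 then ln (\<rho> m) else 0)
        + (\<Sum>m'\<in>{1..M} - {m}. LINT z:s m ` \<Gamma> \<times> s m' ` \<Gamma>|\<nu>. \<Phi> t (fst z) (snd z)))"
proof -
  let ?E = "LINT z:\<Gamma> \<times> \<Gamma>|\<nu>. \<Phi> t (fst z) (snd z)"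
  let ?B = "\<lambda>m m'. LINT z:s m ` \<Gamma> \<times> s m' ` \<Gamma>|\<nu>. \<Phi> t (fst z) (snd z)"
  have "energy_integral \<Gamma> \<mu> \<mu>' (\<Phi> t) = ?E"
    unfolding energy_integral_def using P.set_integral_Times[OF int] by simp
  moreover have "?E = (\<Sum>m=1..M. ?B m m + (\<Sum>m'\<in>{1..M} - {m}. ?B m m'))"
    unfolding block_decomposition[OF int] by (intro sum.cong refl sum.remove) auto
  moreover have "\<dots> = (\<Sum>m=1..M. p m * p' m * measure \<mu> \<Gamma> * measure \<mu>' \<Gamma> * (if t = 0 then ln (\<rho> m) else 0)
        + (\<Sum>m'\<in>{1..M} - {m}. ?B m m')) + (\<Sum>m=1..M. p m * p' m * \<rho> m powr (- t)) * ?E"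
    unfolding sum_distrib_right sum.distrib[symmetric]
    by (intro sum.cong refl) (simp only: diagonal_energy[OF _ int] algebra_simps)
  ultimately show ?thesis by (simp add: algebra_simps)
qed

text \<open>
  Both cases of the definition in one formula, which has the shape of the recursion for the integral.
\<close>

lemma energy_rule_eq:
  "energy_rule M \<rho> s \<Gamma> p p' \<mu> \<mu>' h t
    = inverse (1 - (\<Sum>m=1..M. p m * p' m * \<rho> m powr (- t)))
      * (\<Sum>m=1..M. p m * p' m * measure \<mu> \<Gamma> * measure \<mu>' \<Gamma> * (if t = 0 then ln (\<rho> m) else 0)
          + (\<Sum>m'\<in>{1..M} - {m}. barycentre_rule M s \<Gamma> \<mu> \<mu>' h m m' (\<Phi> t)))"
proof (cases "t = 0")
  case True
  have "(\<Sum>m=1..M. p m * p' m * \<rho> m powr (- t)) = (\<Sum>m=1..M. p m * p' m)"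
    using ratio(1) True by (intro sum.cong) (auto simp: less_le)
  then show ?thesis using True by (simp add: energy_rule_def)
qed (simp add: energy_rule_def)

lemma energy_rule_error:
  assumes t: "0 \<le> t" and contract: "(\<Sum>m=1..M. p m * p' m * \<rho> m powr (- t)) < 1"
    and h: "0 < h" "h < diameter \<Gamma>" and R: "0 < R_Hull_h M s \<Gamma> h"
  shows "\<bar>energy_integral \<Gamma> \<mu> \<mu>' (\<Phi> t) - energy_rule M \<rho> s \<Gamma> p p' \<mu> \<mu>' h t\<bar>
    \<le> 2 * a_const t * h\<^sup>2 * measure \<mu> \<Gamma> * measure \<mu>' \<Gamma>
        / ((1 - (\<Sum>m=1..M. p m * p' m * \<rho> m powr (- t))) * R_Hull_h M s \<Gamma> h powr (t + 2))"
proof -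
  define c where "c = (\<Sum>m=1..M. p m * p' m * \<rho> m powr (- t))"
  define C where "C = 2 * a_const t * h\<^sup>2 / R_Hull_h M s \<Gamma> h powr (t + 2)"
  let ?B = "\<lambda>m m'. LINT z:s m ` \<Gamma> \<times> s m' ` \<Gamma>|\<nu>. \<Phi> t (fst z) (snd z)"
  let ?Q = "\<lambda>m m'. barycentre_rule M s \<Gamma> \<mu> \<mu>' h m m' (\<Phi> t)"
  let ?V = "\<lambda>m m'. C * measure \<mu> (s m ` \<Gamma>) * measure \<mu>' (s m' ` \<Gamma>)"
  have c: "0 < 1 - c" using contract by (simp add: c_def)
  have C: "0 \<le> C" using a_const_nonneg[OF t] by (simp add: C_def)
  have "(1 - c) * (energy_integral \<Gamma> \<mu> \<mu>' (\<Phi> t) - energy_rule M \<rho> s \<Gamma> p p' \<mu> \<mu>' h t)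
      = (\<Sum>m=1..M. \<Sum>m'\<in>{1..M} - {m}. ?B m m' - ?Q m m')"
    using c energy_integral_recursion[OF kernel_integrable[OF t contract]]
    unfolding energy_rule_eq c_def[symmetric] right_diff_distrib
    by (simp only: sum_subtractf sum.distrib) (simp add: mult.assoc[symmetric])
  then have "(1 - c) * \<bar>energy_integral \<Gamma> \<mu> \<mu>' (\<Phi> t) - energy_rule M \<rho> s \<Gamma> p p' \<mu> \<mu>' h t\<bar>
      = \<bar>\<Sum>m=1..M. \<Sum>m'\<in>{1..M} - {m}. ?B m m' - ?Q m m'\<bar>"
    using c by (metis abs_mult abs_of_pos)
  also have "\<dots> \<le> (\<Sum>m=1..M. \<Sum>m'\<in>{1..M} - {m}. \<bar>?B m m' - ?Q m m'\<bar>)"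
    by (intro order_trans[OF sum_abs] sum_mono sum_abs)
  also have "\<dots> \<le> (\<Sum>m=1..M. \<Sum>m'\<in>{1..M} - {m}. ?V m m')"
    unfolding C_def by (intro sum_mono off_diagonal_error t h R) auto
  also have "\<dots> \<le> (\<Sum>m=1..M. \<Sum>m'=1..M. ?V m m')"
    using C by (intro sum_mono sum_mono2) auto
  also have "\<dots> = C * (\<Sum>m=1..M. measure \<mu> (s m ` \<Gamma>)) * (\<Sum>m'=1..M. measure \<mu>' (s m' ` \<Gamma>))"
    by (subst mult.assoc, subst sum_product) (simp only: sum_distrib_left mult.assoc)
  also have "\<dots> = C * measure \<mu> \<Gamma> * measure \<mu>' \<Gamma>"
    by (simp only: X.sum_measure_images Y.sum_measure_images)
  finally have "\<bar>energy_integral \<Gamma> \<mu> \<mu>' (\<Phi> t) - energy_rule M \<rho> s \<Gamma> p p' \<mu> \<mu>' h t\<bar>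
      \<le> C * measure \<mu> \<Gamma> * measure \<mu>' \<Gamma> / (1 - c)"
    using c by (simp add: pos_le_divide_eq mult.commute)
  then show ?thesis by (simp add: C_def c_def mult.commute)
qed

end

theorem corollary4p7:
  fixes M :: nat
    and \<rho> :: "nat \<Rightarrow> real"
    and A :: "nat \<Rightarrow> real ^ 'n ^ 'n"
    and \<delta> :: "nat \<Rightarrow> real ^ 'n"
    and s :: "nat \<Rightarrow> real ^ 'n \<Rightarrow> real ^ 'n"
    and \<Gamma> :: "(real ^ 'n) set"
    and p p' :: "nat \<Rightarrow> real"
    and \<mu> \<mu>' :: "(real ^ 'n) measure"
    and t h :: real
  assumes "similarity_ifs M \<rho> A \<delta> s"
    and "open_set_condition M s"
    and "is_attractor M s \<Gamma>"
    and "invariant_measure M s \<Gamma> p \<mu>"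
    and "invariant_measure M s \<Gamma> p' \<mu>'"
    and "disjoint_attractor M s \<Gamma>"
    and "0 \<le> t" and "t < t_star M \<rho> p p'"
    and "0 < h" and "h < diameter \<Gamma>"
    and "\<And>w w'. w \<in> L_index M s \<Gamma> h [] \<Longrightarrow> w' \<in> L_index M s \<Gamma> h [] \<Longrightarrow> hd w \<noteq> hd w' \<Longrightarrow>
           convex hull (piece s \<Gamma> w) \<inter> convex hull (piece s \<Gamma> w') = {}"
  shows "\<bar>energy_integral \<Gamma> \<mu> \<mu>' (\<Phi> t) - energy_rule M \<rho> s \<Gamma> p p' \<mu> \<mu>' h t\<bar>
           \<le> 2 * real CARD('n) * a_const t * h\<^sup>2 * measure \<mu> \<Gamma> * measure \<mu>' \<Gamma> /
             ((1 - (\<Sum>m=1..M. p m * p' m * \<rho> m powr (- t))) * R_Hull_h M s \<Gamma> h powr (t + 2))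
         \<and> R_Hull_h M s \<Gamma> h \<ge> R_Hull M s \<Gamma>"
proof -
  interpret ifs_measure_pair M \<rho> A \<delta> s \<Gamma> p \<mu> p' \<mu>'
    using assms(1,3-6)
    by (simp add: ifs_measure_pair_def invariant_ifs_measure_def disjoint_ifs_def
        invariant_ifs_measure_axioms_def)
  have R: "0 < R_Hull_h M s \<Gamma> h"
    using assms(9-11) by (rule R_Hull_h_pos)
  have contract: "(\<Sum>m=1..M. p m * p' m * \<rho> m powr (- t)) < 1"
    using assms(7,8) by (rule sum_less_1_of_less_t_star)
  let ?D = "(1 - (\<Sum>m=1..M. p m * p' m * \<rho> m powr (- t))) * R_Hull_h M s \<Gamma> h powr (t + 2)"
  let ?e = "a_const t * h\<^sup>2 * measure \<mu> \<Gamma> * measure \<mu>' \<Gamma>"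
  have "\<bar>energy_integral \<Gamma> \<mu> \<mu>' (\<Phi> t) - energy_rule M \<rho> s \<Gamma> p p' \<mu> \<mu>' h t\<bar> \<le> 2 * ?e / ?D"
    using energy_rule_error[OF assms(7) contract assms(9,10) R] by (simp only: mult.assoc)
  also have "\<dots> \<le> 2 * real CARD('n) * ?e / ?D"
  proof (rule divide_right_mono)
    have "0 \<le> ?e" using a_const_nonneg[OF assms(7)] by simp
    moreover have "1 \<le> real CARD('n)" by (simp add: Suc_leI)
    ultimately have "1 * ?e \<le> real CARD('n) * ?e" by (intro mult_right_mono)
    then show "2 * ?e \<le> 2 * real CARD('n) * ?e" by simp
    show "0 \<le> ?D" using contract by simp
  qed
  finally have "\<bar>energy_integral \<Gamma> \<mu> \<mu>' (\<Phi> t) - energy_rule M \<rho> s \<Gamma> p p' \<mu> \<mu>' h t\<bar>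
      \<le> 2 * real CARD('n) * a_const t * h\<^sup>2 * measure \<mu> \<Gamma> * measure \<mu>' \<Gamma> / ?D"
    by (simp only: mult.assoc)
  then show ?thesis using R_Hull_le_R_Hull_h[OF assms(9,10)] by blast
qed

end
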